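(* For $z$ in the closed unit disk define, for each positive integer $m$, \[ g_m(z)=\begin{cases} f_m(z)=\frac1m\Re\sqrt{\mathrm{Li}_2(z^m)}, & m \text{ odd},\\[2pt] \frac1k f_1(-z^k)=\frac1k\Re\sqrt{\mathrm{Li}_2(-z^k)}, & m=2k \text{ even},\end{cases} \] and $R(m)=\{z\in\mathbb{D}\setminus\{0\}: g_m(z)>g_l(z)\text{ for all } l\ne m\}$. Then exactly three of these sets are nonempty, namely $R(1)$, $R(2)$, $R(4)$. Moreover, letting $\gamma=\{z\in\mathbb{D}: \Re z\ge 0,\ \Im z\ge0,\ g_1(z)=g_4(z)\}$ and $\beta$ the unique solution in $(0,1]$ of $f_1(ir)=f_2(r)$: (1) $\partial R(4)\cap\mathbb{D}=\gamma\cup(-\gamma)\cup\overline{\gamma}\cup(-\overline{\gamma})$; (2) $\partial R(1)\cap\mathbb{D}=i[0,\beta]\cup i[-\beta,0]\cup\gamma\cup\overline{\gamma}$; (3) $\partial R(2)\cap\mathbb{D}=i[0,\beta]\cup i[-\beta,0]\cup(-\gamma)\cup(-\overline{\gamma})$.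
   Context: $\mathbb{D}$ is the open unit disk. $\mathrm{Li}_2(z)=\sum_{n\ge1}z^n/n^2$ for $|z|\le 1$, and $\sqrt{\cdot}$ is the principal square root (nonnegative real part), so $f_k(z)=\frac1k\Re\sqrt{\mathrm{Li}_2(z^k)}$. These $g_m$ are (up to the common factor $1/\sqrt2$) the real parts of the phase functions for the partition polynomials counting partitions into odd parts by number of parts, and the $R(m)$ are the corresponding phases.
   Formalization: The curve γ is taken in the disk with the origin removed: g_1(0)=g_4(0)=0 would put 0 in γ, but R(4) avoids a neighbourhood of 0, so (1) as written fails at that one point; (2) and (3) are unaffected. *)

theory Defs
  imports "HOL-Analysis.Analysis"
begin

definition Li2 :: "complex \<Rightarrow> complex" where
  "Li2 z = (\<Sum>n. z ^ Suc n / of_nat (Suc n) ^ 2)"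

definition f_phase :: "nat \<Rightarrow> complex \<Rightarrow> real" where
  "f_phase k z = 1 / real k * Re (csqrt (Li2 (z ^ k)))"

text \<open>Only indices \<open>m \<ge> 1\<close> are meaningful; all uses below are restricted to them.\<close>

definition g_phase :: "nat \<Rightarrow> complex \<Rightarrow> real" where
  "g_phase m z =
     (if odd m then f_phase m z
      else 1 / real (m div 2) * f_phase 1 (- (z ^ (m div 2))))"

definition R_phase :: "nat \<Rightarrow> complex set" where
  "R_phase m = {z \<in> ball 0 1 - {0}. \<forall>l\<ge>1. l \<noteq> m \<longrightarrow> g_phase m z > g_phase l z}"

text \<open>
  The origin is left out, as it is in the sets \<open>R_phase m\<close>: all \<open>g_phase m\<close> vanish at \<open>0\<close>,
  so it satisfies the equation trivially, but it is not a boundary point of \<open>R_phase 4\<close>.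
\<close>

definition gamma_curve :: "complex set" where
  "gamma_curve =
     {z \<in> ball 0 1 - {0}. Re z \<ge> 0 \<and> Im z \<ge> 0 \<and> g_phase 1 z = g_phase 4 z}"

definition is_beta :: "real \<Rightarrow> bool" where
  "is_beta r \<longleftrightarrow> r \<in> {0<..1} \<and> f_phase 1 (\<i> * of_real r) = f_phase 2 (of_real r)"

definition imag_seg :: "real \<Rightarrow> real \<Rightarrow> complex set" where
  "imag_seg a b = (\<lambda>t. \<i> * of_real t) ` {a..b}"

end

theory Submission
  imports Defs
begin

text \<open>
  Since \<open>Re (csqrt w) = sqrt ((|w| + Re w) / 2)\<close>, every phase is a comparison of values of
  \<open>P z = |Li2 z| + Re (Li2 z)\<close>. The key fact is that on each circle \<open>|z| = r < 1\<close> the function \<open>P\<close> is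
  strictly increasing in \<open>Re z\<close>; this reduces to \<open>Im (Li1 z * cnj (Li2 z)) > 0\<close> in the upper half disc,
  i.e. the argument of \<open>Li1\<close> exceeds that of \<open>Li2\<close>, which follows by differentiating along rays.
  Hence \<open>g_1 > g_2\<close> exactly where \<open>Re z > 0\<close>, and in the right half disc the gap
  \<open>P z - P (- z\<^sup>2) / 4\<close> deciding between \<open>g_1\<close> and \<open>g_4\<close> is strictly increasing in \<open>Re z\<close> on circles,
  so the gap changes sign at each of its zeros. On the imaginary axis the sign of the gap reduces to the
  comparison of a decreasing with an increasing function of \<open>r\<close>, which gives the unique \<open>\<beta>\<close>.
  The remaining phases satisfy \<open>2 g_l\<^sup>2 \<le> \<pi>\<^sup>2 r / 27 < P (\<i> r)\<close> and never dominate.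
\<close>

subsection \<open>Polylogarithms on rays\<close>

text \<open>The power series of Li_s(z) / z, regular at the origin. It is the derivative of Li_(s+1)
  on the whole disc, so the relation z Li_(s+1)' = Li_s is available without dividing by z.\<close>

definition polylog_quot :: "nat \<Rightarrow> complex \<Rightarrow> complex" where
  "polylog_quot s z = (\<Sum>n. z ^ n / of_nat (Suc n) ^ s)"

definition polylog :: "nat \<Rightarrow> complex \<Rightarrow> complex" where
  "polylog s z = z * polylog_quot s z"

lemma summable_polylog_quot:
  fixes z :: "'a::{real_normed_field,banach}"
  assumes "norm z < 1"
  shows "summable (\<lambda>n. z ^ n / of_nat (Suc n) ^ s)"
proof (rule summable_comparison_test')
  show "summable (\<lambda>n. norm z ^ n)"
    using assms by (simp add: summable_geometric)
  show "norm (z ^ n / of_nat (Suc n) ^ s) \<le> norm z ^ n" for n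
  proof -
    have "norm (of_nat (Suc n) ^ s :: 'a) \<ge> 1"
      unfolding norm_power norm_of_nat by (rule one_le_power) (simp del: of_nat_Suc)
    then have "norm z ^ n / norm (of_nat (Suc n) ^ s :: 'a) \<le> norm z ^ n / 1"
      by (intro divide_left_mono) (auto simp del: of_nat_Suc simp: zero_less_power)
    then show ?thesis by (simp add: norm_divide norm_power del: of_nat_Suc)
  qed
qed

lemma polylog_quot_0_left:
  assumes "norm z < 1"
  shows "polylog_quot 0 z = 1 / (1 - z)"
  using assms by (simp add: polylog_quot_def suminf_geometric)

lemma has_field_derivative_polylog:
  assumes "norm z < 1"
  shows "(polylog (Suc s) has_field_derivative polylog_quot s z) (at z)"
proof -
  \<comment> \<open>At \<open>n = 0\<close> the coefficient is \<open>1 / 0 = 0\<close>, so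
    \<open>c\<close> already describes a series without constant term.\<close>
  define c :: "nat \<Rightarrow> complex" where "c n = 1 / of_nat n ^ Suc s" for n
  have c: "c (Suc n) * w ^ Suc n = w * (w ^ n / of_nat (Suc n) ^ Suc s)" for n w
    by (simp add: c_def)
  have summable: "summable (\<lambda>n. c n * w ^ n)" if "norm w < 1" for w
    unfolding summable_Suc_iff[of "\<lambda>n. c n * w ^ n", symmetric] c
    by (intro summable_mult summable_polylog_quot that)
  have eq: "(\<Sum>n. c n * w ^ n) = polylog (Suc s) w" if "norm w < 1" for w
  proof -
    have "(\<Sum>n. c n * w ^ n) = (\<Sum>n. c (Suc n) * w ^ Suc n)"
      using suminf_split_head[OF summable[OF that]] by (simp add: c_def)
    also have "\<dots> = polylog (Suc s) w"
      unfolding c polylog_def polylog_quot_def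
      by (rule suminf_mult[OF summable_polylog_quot[OF that]])
    finally show ?thesis .
  qed
  have diffs: "diffs c = (\<lambda>n. 1 / of_nat (Suc n) ^ s)"
    by (simp add: diffs_def c_def fun_eq_iff del: of_nat_Suc)
  obtain K where K: "norm z < K" "K < 1"
    using assms dense by blast
  have "((\<lambda>w. \<Sum>n. c n * w ^ n) has_field_derivative (\<Sum>n. diffs c n * z ^ n)) (at z)"
    by (rule termdiffs_strong[of c "of_real K"]) (use K order_le_less_trans[OF norm_ge_zero K(1)] in \<open>auto intro!: summable\<close>)
  then have D: "((\<lambda>w. \<Sum>n. c n * w ^ n) has_field_derivative polylog_quot s z) (at z)"
    by (simp add: diffs polylog_quot_def)
  show ?thesis
    by (rule has_field_derivative_transform_within_open[OF D, of "ball 0 1"])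
       (use assms eq in auto)
qed

lemma continuous_on_polylog: "continuous_on (ball 0 1) (polylog (Suc s))"
  by (rule DERIV_continuous_on[OF has_field_derivative_at_within[OF has_field_derivative_polylog]]) simp

lemma has_vector_derivative_polylog_ray:
  assumes "norm (of_real t * z) < 1"
  shows "((\<lambda>t. polylog (Suc s) (of_real t * z)) has_vector_derivative
          z * polylog_quot s (of_real t * z)) (at t)"
proof -
  have "((\<lambda>t. of_real t * z) has_vector_derivative of_real 1 * z) (at t)"
    by (intro has_vector_derivative_mult_left has_vector_derivative_of_real)
       (auto simp flip: has_real_derivative_iff_has_vector_derivative)
  then have "((polylog (Suc s) \<circ> (\<lambda>t. of_real t * z)) has_vector_derivative
          (of_real 1 * z) * polylog_quot s (of_real t * z)) (at t)"
    by (rule field_vector_diff_chain_at[where f = "\<lambda>t. of_real t * z" and x = t])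
       (rule has_field_derivative_polylog[OF assms])
  then show ?thesis by (simp add: o_def)
qed

lemma has_real_derivative_polylog_ray:
  assumes "norm (of_real t * z) < 1"
  shows "((\<lambda>t. Re (polylog (Suc s) (of_real t * z))) has_real_derivative
            Re (z * polylog_quot s (of_real t * z))) (at t)"
    and "((\<lambda>t. Im (polylog (Suc s) (of_real t * z))) has_real_derivative
            Im (z * polylog_quot s (of_real t * z))) (at t)"
  unfolding has_real_derivative_iff_has_vector_derivative
  by (rule bounded_linear.has_vector_derivative[OF bounded_linear_Re has_vector_derivative_polylog_ray[OF assms]]
           bounded_linear.has_vector_derivative[OF bounded_linear_Im has_vector_derivative_polylog_ray[OF assms]])+

lemma norm_ray_less:
  assumes "norm (z::complex) < 1" "0 \<le> t" "t \<le> 1"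
  shows "norm (of_real t * z) < 1"
  using assms by (simp add: norm_mult) (metis mult_left_le_one_le norm_ge_zero order_le_less_trans)

text \<open>The quantity is z / (1 - t z), the derivative of Li_1 along the ray, with its
  denominator made real; \<open>N\<close> is the squared modulus of 1 - t z.\<close>

lemma ray_quotient:
  assumes *: "norm (of_real t * z) < 1"
  defines "N \<equiv> (1 - t * Re z)\<^sup>2 + (t * Im z)\<^sup>2"
  shows "N > 0"
    and "Re (z * polylog_quot 0 (of_real t * z)) = (Re z - t * (norm z)\<^sup>2) / N"
    and "Im (z * polylog_quot 0 (of_real t * z)) = Im z / N"
proof -
  have "1 - of_real t * z \<noteq> 0"
    using * by force
  moreover have N: "N = (norm (1 - of_real t * z))\<^sup>2"
    unfolding cmod_power2 N_def by simp
  ultimately show "N > 0" by simp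
  have "z * polylog_quot 0 (of_real t * z) = z / (1 - of_real t * z)"
    using * by (simp add: polylog_quot_0_left)
  also have "\<dots> = z * cnj (1 - of_real t * z) / of_real N"
    unfolding N by (metis complex_div_cnj of_real_power)
  finally have eq: "z * polylog_quot 0 (of_real t * z) = z * cnj (1 - of_real t * z) / of_real N" .
  show "Re (z * polylog_quot 0 (of_real t * z)) = (Re z - t * (norm z)\<^sup>2) / N"
    unfolding eq cmod_power2 by (simp add: power2_eq_square algebra_simps diff_divide_distrib add_divide_distrib)
  show "Im (z * polylog_quot 0 (of_real t * z)) = Im z / N"
    unfolding eq by (simp add: power2_eq_square algebra_simps)
qed

text \<open>Expresses the derivative of Li_(s+1) along the ray through Li_s, with the factor
  \<open>t\<close> kept on the left to avoid a division.\<close>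

lemma polylog_ray: "t * Re (z * polylog_quot s (of_real t * z)) = Re (polylog s (of_real t * z))"
  "t * Im (z * polylog_quot s (of_real t * z)) = Im (polylog s (of_real t * z))"
  by (simp_all add: polylog_def algebra_simps)

lemma polylog_0 [simp]: "polylog s 0 = 0"
  by (simp add: polylog_def)

lemma continuous_on_polylog_ray:
  assumes "norm z < 1"
  shows "continuous_on {0..1} (\<lambda>t. polylog (Suc s) (of_real t * z))"
proof (rule continuous_on_compose2[OF continuous_on_polylog])
  show "(\<lambda>t. complex_of_real t * z) ` {0..1} \<subseteq> ball 0 1"
    using norm_ray_less[OF assms] by auto
qed (intro continuous_intros)

section \<open>Comparison of the arguments of Li_0, Li_1 and Li_2 in the upper half disc\<close>

lemma Im_polylog_1_pos:
  assumes "norm z < 1" "Im z > 0"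
  shows "Im (polylog 1 z) > 0"
proof -
  let ?f = "\<lambda>t. Im (polylog (Suc 0) (of_real t * z))"
  have "?f 0 < ?f 1"
  proof (rule DERIV_pos_imp_increasing_open[of 0 1 ?f])
    fix t :: real assume t: "0 < t" "t < 1"
    then have n: "norm (of_real t * z) < 1"
      using norm_ray_less[OF assms(1), of t] by simp
    show "\<exists>y. (?f has_real_derivative y) (at t) \<and> 0 < y"
      using has_real_derivative_polylog_ray(2)[OF n, of 0] ray_quotient[OF n] t assms(2)
      by auto
  qed (auto intro!: continuous_intros continuous_on_polylog_ray assms)
  then show ?thesis by simp
qed

lemma Im_polylog_2_pos:
  assumes "norm z < 1" "Im z > 0"
  shows "Im (polylog 2 z) > 0"
proof -
  let ?f = "\<lambda>t. Im (polylog (Suc 1) (of_real t * z))"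
  have "?f 0 < ?f 1"
  proof (rule DERIV_pos_imp_increasing_open[of 0 1 ?f])
    fix t :: real assume t: "0 < t" "t < 1"
    then have n: "norm (of_real t * z) < 1"
      using norm_ray_less[OF assms(1), of t] by simp
    have "t * Im (z * polylog_quot 1 (of_real t * z)) > 0"
      unfolding polylog_ray using t assms by (intro Im_polylog_1_pos n) auto
    then show "\<exists>y. (?f has_real_derivative y) (at t) \<and> 0 < y"
      using has_real_derivative_polylog_ray(2)[OF n, of 1] t by (auto simp: zero_less_mult_iff)
  qed (auto intro!: continuous_intros continuous_on_polylog_ray assms)
  then show ?thesis by (simp add: numeral_2_eq_2)
qed

text \<open>With Li_0 z = z / (1 - z), the left side is |1 - z|^2 Im (Li_0 z * cnj (Li_1 z)), so
  this is the first rung of the ladder: the argument of Li_0 exceeds that of Li_1.\<close>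

lemma Im_mult_cnj_polylog_1_pos:
  assumes "norm z < 1" "Im z > 0"
  shows "Im (z * cnj (polylog 1 z)) + (norm z)\<^sup>2 * Im (polylog 1 z) > 0"
proof -
  let ?p = "\<lambda>t. Re (polylog (Suc 0) (of_real t * z))"
  let ?q = "\<lambda>t. Im (polylog (Suc 0) (of_real t * z))"
  \<comment> \<open>This is the expression at \<open>t z\<close> divided by \<open>t\<close>. In its
    derivative the contributions of the derivative of Li_1 cancel, and only |z|^2 Im (Li_1 (t z))
    remains.\<close>
  let ?f = "\<lambda>t. Im z * ?p t - Re z * ?q t + t * (norm z)\<^sup>2 * ?q t"
  have z: "z \<noteq> 0" using assms by auto
  have "?f 0 < ?f 1"
  proof (rule DERIV_pos_imp_increasing_open[of 0 1 ?f])
    fix t :: real assume t: "0 < t" "t < 1"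
    then have n: "norm (of_real t * z) < 1"
      using norm_ray_less[OF assms(1), of t] by simp
    note D = has_real_derivative_polylog_ray[OF n, of 0]
    define a where "a = inverse ((1 - t * Re z)\<^sup>2 + (t * Im z)\<^sup>2)"
    note Q = ray_quotient[OF n,
        unfolded divide_inverse, folded a_def]
    have "(?f has_real_derivative Im z * Re (z * polylog_quot 0 (of_real t * z))
        - Re z * Im (z * polylog_quot 0 (of_real t * z))
        + ((norm z)\<^sup>2 * ?q t + Im (z * polylog_quot 0 (of_real t * z)) * (t * (norm z)\<^sup>2))) (at t)"
      by (rule derivative_eq_intros D refl | simp)+
    also have "Im z * Re (z * polylog_quot 0 (of_real t * z))
        - Re z * Im (z * polylog_quot 0 (of_real t * z))
        + ((norm z)\<^sup>2 * ?q t + Im (z * polylog_quot 0 (of_real t * z)) * (t * (norm z)\<^sup>2))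
        = (norm z)\<^sup>2 * ?q t"
      unfolding Q(2,3) by (simp only: algebra_simps)
    finally have "(?f has_real_derivative (norm z)\<^sup>2 * ?q t) (at t)" .
    moreover have "?q t > 0"
      using Im_polylog_1_pos[OF n] t assms by simp
    ultimately show "\<exists>y. (?f has_real_derivative y) (at t) \<and> 0 < y"
      using z by (intro exI[of _ "(norm z)\<^sup>2 * ?q t"] conjI mult_pos_pos) auto
  qed (auto intro!: continuous_intros continuous_on_polylog_ray assms)
  then show ?thesis by (simp add: algebra_simps)
qed

text \<open>Second rung, Im (Li_0 z * cnj (Li_2 z)) > 0 up to the factor |1 - z|^2. The derivative
  of \<open>?f\<close> is the previous expression at \<open>t z\<close> divided by t^2, plus the
  nonnegative term |z|^2 Im (Li_2 (t z)).\<close>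

lemma Im_mult_cnj_polylog_2_pos:
  assumes "norm z < 1" "Im z > 0"
  shows "Im (z * cnj (polylog 2 z)) + (norm z)\<^sup>2 * Im (polylog 2 z) > 0"
proof -
  let ?p = "\<lambda>t. Re (polylog (Suc 1) (of_real t * z))"
  let ?q = "\<lambda>t. Im (polylog (Suc 1) (of_real t * z))"
  let ?f = "\<lambda>t. Im z * ?p t - Re z * ?q t + t * (norm z)\<^sup>2 * ?q t"
  have "?f 0 < ?f 1"
  proof (rule DERIV_pos_imp_increasing_open[of 0 1 ?f])
    fix t :: real assume t: "0 < t" "t < 1"
    then have n: "norm (of_real t * z) < 1" and i: "Im (of_real t * z) > 0"
      using norm_ray_less[OF assms(1), of t] assms(2) by simp_all
    note D = has_real_derivative_polylog_ray[OF n, of 1]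
    let ?u = "Re (z * polylog_quot 1 (of_real t * z))"
    let ?v = "Im (z * polylog_quot 1 (of_real t * z))"
    have D': "(?f has_real_derivative Im z * ?u - Re z * ?v
        + ((norm z)\<^sup>2 * ?q t + ?v * (t * (norm z)\<^sup>2))) (at t)"
      by (rule derivative_eq_intros D refl | simp)+
    have "Im z * (t * ?u) * t - Re z * (t * ?v) * t + t\<^sup>2 * (norm z)\<^sup>2 * (t * ?v) > 0"
      using Im_mult_cnj_polylog_1_pos[OF n i] t
      unfolding polylog_ray by (simp add: norm_mult power_mult_distrib algebra_simps)
    then have "t\<^sup>2 * (Im z * ?u - Re z * ?v + ?v * (t * (norm z)\<^sup>2)) > 0"
      by (simp add: algebra_simps power2_eq_square)
    then have "Im z * ?u - Re z * ?v + ?v * (t * (norm z)\<^sup>2) > 0"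
      by (simp add: zero_less_mult_iff)
    moreover have "?q t > 0"
      using Im_polylog_2_pos[OF n i] by (simp add: numeral_2_eq_2)
    then have "(norm z)\<^sup>2 * ?q t \<ge> 0" by simp
    ultimately show "\<exists>y. (?f has_real_derivative y) (at t) \<and> 0 < y"
      using D' by (intro exI conjI) (assumption, linarith)
  qed (auto intro!: continuous_intros continuous_on_polylog_ray assms)
  then show ?thesis by (simp add: algebra_simps numeral_2_eq_2)
qed

text \<open>Along the ray, t times the derivative is Im (Li_0 * cnj Li_2) + Im (Li_1 * cnj Li_1) at
  \<open>t z\<close>. The second term vanishes and the first is positive by the preceding
  rung.\<close>

lemma Im_polylog_1_mult_cnj_polylog_2_pos:
  assumes "norm z < 1" "Im z > 0"
  shows "Im (polylog 1 z * cnj (polylog 2 z)) > 0"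
proof -
  let ?p = "\<lambda>t. Re (polylog (Suc 0) (of_real t * z))"
  let ?q = "\<lambda>t. Im (polylog (Suc 0) (of_real t * z))"
  let ?u = "\<lambda>t. Re (polylog (Suc 1) (of_real t * z))"
  let ?v = "\<lambda>t. Im (polylog (Suc 1) (of_real t * z))"
  let ?f = "\<lambda>t. ?q t * ?u t - ?p t * ?v t"
  have "?f 0 < ?f 1"
  proof (rule DERIV_pos_imp_increasing_open[of 0 1 ?f])
    fix t :: real assume t: "0 < t" "t < 1"
    then have n: "norm (of_real t * z) < 1" and i: "Im (of_real t * z) > 0"
      using norm_ray_less[OF assms(1), of t] assms(2) by simp_all
    define a where "a = inverse ((1 - t * Re z)\<^sup>2 + (t * Im z)\<^sup>2)"
    note Q = ray_quotient[OF n,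
        unfolded divide_inverse, folded a_def]
    let ?U = "Re (z * polylog_quot 1 (of_real t * z))"
    let ?V = "Im (z * polylog_quot 1 (of_real t * z))"
    have "t * ?U = ?p t" "t * ?V = ?q t"
      unfolding polylog_ray by simp_all
    then have UV: "?U = ?p t / t" "?V = ?q t / t"
      using t by (simp_all add: field_simps)
    have D': "(?f has_real_derivative
        Im (z * polylog_quot 0 (of_real t * z)) * ?u t + ?U * ?q t
        - (Re (z * polylog_quot 0 (of_real t * z)) * ?v t + ?V * ?p t)) (at t)"
      by (rule derivative_eq_intros has_real_derivative_polylog_ray[OF n] refl | simp)+
    also have "Im (z * polylog_quot 0 (of_real t * z)) * ?u t + ?U * ?q t
        - (Re (z * polylog_quot 0 (of_real t * z)) * ?v t + ?V * ?p t)
        = Im z * a * ?u t - (Re z - t * (norm z)\<^sup>2) * a * ?v t"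
      unfolding UV Q(2,3) by (simp add: mult.commute)
    also have "\<dots> = (Im z * ?u t - Re z * ?v t + t * (norm z)\<^sup>2 * ?v t) * a"
      by (simp only: algebra_simps)
    finally have D': "(?f has_real_derivative
        (Im z * ?u t - Re z * ?v t + t * (norm z)\<^sup>2 * ?v t) * a) (at t)" .
    have "t * (Im z * ?u t - Re z * ?v t + t * (norm z)\<^sup>2 * ?v t) > 0"
      using Im_mult_cnj_polylog_2_pos[OF n i] t
      by (simp add: norm_mult power_mult_distrib algebra_simps numeral_2_eq_2)
    then have "(Im z * ?u t - Re z * ?v t + t * (norm z)\<^sup>2 * ?v t) * a > 0"
      using t Q(1) by (simp add: zero_less_mult_iff a_def)
    then show "\<exists>y. (?f has_real_derivative y) (at t) \<and> 0 < y"
      using D' by blast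
  qed (auto intro!: continuous_intros continuous_on_polylog_ray assms)
  then show ?thesis by (simp add: algebra_simps numeral_2_eq_2)
qed

subsection \<open>The dilogarithm and the squared phase\<close>

lemma summable_Li2:
  assumes "norm z \<le> 1"
  shows "summable (\<lambda>n. z ^ Suc n / of_nat (Suc n) ^ 2 :: complex)"
proof (rule summable_comparison_test')
  show "summable (\<lambda>n. 1 / real (Suc n) ^ 2)"
    using inverse_squares_sums by (simp add: sums_iff)
  show "norm (z ^ Suc n / of_nat (Suc n) ^ 2) \<le> 1 / real (Suc n) ^ 2" for n
    using power_le_one[OF norm_ge_zero assms, of "Suc n"]
    by (simp add: norm_divide norm_power divide_right_mono norm_mult del: of_nat_Suc)
qed

lemma Li2_sums:
  assumes "norm z \<le> 1"
  shows "(\<lambda>n. z ^ Suc n / of_nat (Suc n) ^ 2) sums Li2 z"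
  unfolding Li2_def by (rule summable_sums[OF summable_Li2[OF assms]])

lemma Li2_conv_polylog:
  assumes "norm z < 1"
  shows "Li2 z = polylog 2 z"
  unfolding Li2_def polylog_def polylog_quot_def
  using suminf_mult[OF summable_polylog_quot[OF assms, of 2], of z] by simp

lemma Li2_0 [simp]: "Li2 0 = 0"
  by (simp add: Li2_def)

text \<open>The M-test with 1 / n^2 reaches the closed disc; the boundary is needed because the
  critical radius is located using the value at \<i>.\<close>

lemma continuous_on_Li2: "continuous_on (cball 0 1) Li2"
proof -
  have "uniform_limit (cball 0 1) (\<lambda>n z. \<Sum>i<n. z ^ Suc i / of_nat (Suc i) ^ 2)
          (\<lambda>z. \<Sum>i. z ^ Suc i / of_nat (Suc i) ^ 2 :: complex) sequentially"
  proof (rule Weierstrass_m_test)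
    show "summable (\<lambda>n. 1 / real (Suc n) ^ 2)"
      using inverse_squares_sums by (simp add: sums_iff)
    show "norm (z ^ Suc n / of_nat (Suc n) ^ 2) \<le> 1 / real (Suc n) ^ 2"
      if "z \<in> cball 0 1" for n and z :: complex
      using power_le_one[of "norm z" "Suc n"] that
      by (simp add: norm_divide norm_power divide_right_mono norm_mult del: of_nat_Suc)
  qed
  then have "uniform_limit (cball 0 1) (\<lambda>n z. \<Sum>i<n. z ^ Suc i / of_nat (Suc i) ^ 2) Li2 sequentially"
    by (simp add: Li2_def[abs_def])
  moreover have "continuous_on (cball 0 1) (\<lambda>z. \<Sum>i<n. z ^ Suc i / of_nat (Suc i) ^ 2 :: complex)" for n
    by (intro continuous_intros) (auto simp del: of_nat_Suc)
  ultimately show ?thesis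
    by (intro uniform_limit_theorem) auto
qed

text \<open>One factor |z| is kept and all further powers are bounded by 1. The bound linear in |z|
  makes the later comparisons uniform in the radius.\<close>

lemma norm_Li2_le:
  assumes "norm z \<le> 1"
  shows "norm (Li2 z) \<le> norm z * (pi\<^sup>2 / 6)"
proof -
  have "norm (Li2 z) \<le> (\<Sum>n. norm z * (1 / real (Suc n) ^ 2))"
    unfolding Li2_def
  proof (rule norm_suminf_le)
    show "norm (z ^ Suc n / of_nat (Suc n) ^ 2) \<le> norm z * (1 / real (Suc n) ^ 2)" for n
      using mult_left_mono[OF power_le_one[OF norm_ge_zero assms, of n] norm_ge_zero[of z]]
      by (simp add: norm_divide norm_power divide_right_mono norm_mult del: of_nat_Suc)
    show "summable (\<lambda>n. norm z * (1 / real (Suc n) ^ 2))"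
      using inverse_squares_sums by (intro summable_mult) (simp add: sums_iff)
  qed
  also have "\<dots> = norm z * (pi\<^sup>2 / 6)"
    using sums_mult[OF inverse_squares_sums, of "norm z"] by (simp add: sums_iff)
  finally show ?thesis .
qed

lemma Li2_1: "Li2 1 = of_real (pi\<^sup>2 / 6)"
proof -
  have "(\<lambda>n. complex_of_real (1 / real (Suc n) ^ 2)) sums of_real (pi\<^sup>2 / 6)"
    using inverse_squares_sums by (intro sums_of_real) simp
  then show ?thesis by (simp add: Li2_def sums_iff)
qed

lemma Li2_cnj:
  assumes "norm z \<le> 1"
  shows "Li2 (cnj z) = cnj (Li2 z)"
proof -
  have "(\<lambda>n. cnj (z ^ Suc n / of_nat (Suc n) ^ 2)) sums cnj (Li2 z)"
    using Li2_sums[OF assms] by (simp only: sums_cnj)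
  then show ?thesis by (simp add: Li2_def sums_iff)
qed

lemma Im_Li2_of_real [simp]:
  assumes "\<bar>x\<bar> \<le> 1"
  shows "Im (Li2 (of_real x)) = 0"
  using Li2_cnj[of "of_real x"] assms by (simp add: complex_eq_iff)

lemma Li2_square:
  assumes "norm z \<le> 1"
  shows "Li2 z + Li2 (- z) = Li2 (z\<^sup>2) / 2"
proof -
  let ?f = "\<lambda>n. z ^ Suc n / of_nat (Suc n) ^ 2 + (- z) ^ Suc n / of_nat (Suc n) ^ 2"
  have 1: "?f sums (Li2 z + Li2 (- z))"
    by (intro sums_add Li2_sums) (use assms in auto)
  \<comment> \<open>The series is indexed from \<open>Suc n\<close>, so the odd indices carry the
    even powers, which are the ones that do not cancel.\<close>
  have 2: "(\<lambda>n. ?f (2 * n + 1)) sums (Li2 (z\<^sup>2) / 2)"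
  proof -
    have "(\<lambda>n. (z\<^sup>2) ^ Suc n / of_nat (Suc n) ^ 2 / 2) sums (Li2 (z\<^sup>2) / 2)"
      by (intro sums_divide Li2_sums) (use assms in \<open>simp add: norm_power power_le_one\<close>)
    moreover have "(z\<^sup>2) ^ Suc n / of_nat (Suc n) ^ 2 / 2 = ?f (2 * n + 1)" for n
    proof -
      have 1: "Suc (2 * n + 1) = 2 * Suc n" by simp
      have "?f (2 * n + 1) = 2 * (z\<^sup>2) ^ Suc n / (4 * of_nat (Suc n) ^ 2)"
        unfolding 1 power_mult of_nat_mult
        by (simp del: of_nat_Suc power_Suc add: power_mult_distrib)
      then show ?thesis by simp
    qed
    ultimately show ?thesis by simp
  qed
  have mono: "strict_mono (\<lambda>n::nat. 2 * n + 1)"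
    by (auto simp: strict_mono_def)
  have "?f n = 0" if "n \<notin> range (\<lambda>n::nat. 2 * n + 1)" for n
  proof -
    have "even n" using that by (metis oddE rangeI)
    then show ?thesis by simp
  qed
  with 2 have "?f sums (Li2 (z\<^sup>2) / 2)"
    by (subst (asm) sums_mono_reindex[OF mono])
  with 1 show ?thesis
    by (rule sums_unique2)
qed

section \<open>The squared phase and its monotonicity on circles\<close>

definition phase_sq :: "complex \<Rightarrow> real" where
  "phase_sq z = norm (Li2 z) + Re (Li2 z)"

lemma phase_sq_nonneg: "phase_sq z \<ge> 0"
  using abs_Re_le_cmod[of "Li2 z"] by (simp add: phase_sq_def)

lemma f_phase_conv: "f_phase k z = sqrt (phase_sq (z ^ k) / 2) / real k"
  by (simp add: f_phase_def phase_sq_def)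

lemma phase_sq_cnj:
  assumes "norm z \<le> 1"
  shows "phase_sq (cnj z) = phase_sq z"
  using assms by (simp add: phase_sq_def Li2_cnj)

lemma continuous_on_phase_sq: "continuous_on (cball 0 1) phase_sq"
  unfolding phase_sq_def[abs_def] by (intro continuous_intros continuous_on_Li2)

lemma phase_sq_le:
  assumes "norm z \<le> 1"
  shows "phase_sq z \<le> norm z * (pi\<^sup>2 / 3)"
  using norm_Li2_le[OF assms] complex_Re_le_cmod[of "Li2 z"] by (simp add: phase_sq_def)

text \<open>
  Along a circle \<open>d Li2 / d\<theta> = \<i> Li1\<close>, so the derivative of \<open>|Li2| + Re Li2\<close> is
  \<open>- Im (Li1 cnj Li2) / |Li2| - Im Li1\<close>, and both terms are negative in the upper half disc.
\<close>

lemma phase_sq_cis_strict_antimono: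
  assumes r: "0 < r" "r < 1" and th: "0 \<le> \<theta>" "\<theta> < \<phi>" "\<phi> \<le> pi"
  shows "phase_sq (of_real r * cis \<phi>) < phase_sq (of_real r * cis \<theta>)"
\<comment> \<open>Only interior angles are differentiated: at 0 and \<pi> the point is real and the
  strict inequalities fail, so the end points are covered by continuity.\<close>
proof (rule DERIV_neg_imp_decreasing_open[where f = "\<lambda>\<theta>. phase_sq (of_real r * cis \<theta>)", OF th(2)])
  fix t assume t: "\<theta> < t" "t < \<phi>"
  define z where "z = of_real r * cis t"
  have z: "norm z < 1" "Im z > 0"
    using r t th by (auto simp: z_def norm_mult intro!: mult_pos_pos sin_gt_zero)
  let ?L = "\<lambda>t. polylog 2 (of_real r * cis t)"
  have "((\<lambda>t. of_real r * cis t) has_vector_derivative of_real r * (\<i> * cis t)) (at t)"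
    using has_derivative_cis[OF has_derivative_ident, of t UNIV]
    by (intro has_vector_derivative_mult_right) (simp add: has_vector_derivative_def)
  moreover have "(polylog 2 has_field_derivative polylog_quot 1 z) (at (of_real r * cis t))"
    using has_field_derivative_polylog[OF z(1), of 1] unfolding z_def Suc_1 .
  ultimately have "((polylog 2 \<circ> (\<lambda>t. of_real r * cis t)) has_vector_derivative
      (of_real r * (\<i> * cis t)) * polylog_quot 1 z) (at t)"
    by (rule field_vector_diff_chain_at[where f = "\<lambda>t. of_real r * cis t" and x = t])
  moreover have "(of_real r * (\<i> * cis t)) * polylog_quot 1 z = \<i> * polylog 1 z"
    by (simp add: polylog_def z_def mult_ac)
  ultimately have D: "(?L has_vector_derivative \<i> * polylog 1 z) (at t)"
    by (simp only: o_def)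
  have Re: "((\<lambda>t. Re (?L t)) has_real_derivative - Im (polylog 1 z)) (at t)"
    using bounded_linear.has_vector_derivative[OF bounded_linear_Re D]
    by (simp add: has_real_derivative_iff_has_vector_derivative)
  have Im: "((\<lambda>t. Im (?L t)) has_real_derivative Re (polylog 1 z)) (at t)"
    using bounded_linear.has_vector_derivative[OF bounded_linear_Im D]
    by (simp add: has_real_derivative_iff_has_vector_derivative)
  have N: "norm (polylog 2 z) > 0"
    using Im_polylog_2_pos[OF z] by auto
  then have N': "(Re (?L t))\<^sup>2 + (Im (?L t))\<^sup>2 > 0"
    unfolding z_def by (simp only: flip: cmod_power2) simp
  \<comment> \<open>Half the derivative of |Li_2|^2, equal to - Im (Li_1 * cnj Li_2).\<close>
  define d where "d = Im (polylog 2 z) * Re (polylog 1 z) - Re (polylog 2 z) * Im (polylog 1 z)"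
  have "((\<lambda>t. (Re (?L t))\<^sup>2 + (Im (?L t))\<^sup>2) has_real_derivative 2 * d) (at t)"
    by (rule derivative_eq_intros Re Im refl)+ (simp add: z_def d_def)
  then have "((\<lambda>t. sqrt ((Re (?L t))\<^sup>2 + (Im (?L t))\<^sup>2)) has_real_derivative
     inverse (sqrt ((Re (?L t))\<^sup>2 + (Im (?L t))\<^sup>2)) / 2 * (2 * d)) (at t)"
    by (rule DERIV_chain2[where g = "\<lambda>t. (Re (?L t))\<^sup>2 + (Im (?L t))\<^sup>2", rotated])
       (rule DERIV_real_sqrt[OF N'])
  then have "((\<lambda>t. norm (?L t) + Re (?L t)) has_real_derivative
     inverse (norm (?L t)) / 2 * (2 * d) + - Im (polylog 1 z)) (at t)"
    unfolding norm_complex_def by (intro DERIV_add Re)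
  also have "inverse (norm (?L t)) / 2 * (2 * d) + - Im (polylog 1 z)
     = - (Im (polylog 1 z * cnj (polylog 2 z)) / norm (polylog 2 z)) - Im (polylog 1 z)"
    unfolding z_def[symmetric] d_def using N by (simp add: divide_simps)
  also have "(\<lambda>t. norm (?L t) + Re (?L t)) = (\<lambda>t. phase_sq (of_real r * cis t))"
    using r by (simp add: phase_sq_def Li2_conv_polylog norm_mult)
  finally have "((\<lambda>\<theta>. phase_sq (of_real r * cis \<theta>)) has_real_derivative
     - (Im (polylog 1 z * cnj (polylog 2 z)) / norm (polylog 2 z)) - Im (polylog 1 z)) (at t)" .
  moreover have "Im (polylog 1 z * cnj (polylog 2 z)) / norm (polylog 2 z) > 0"
    using Im_polylog_1_mult_cnj_polylog_2_pos[OF z] N by (rule divide_pos_pos)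
  ultimately show "\<exists>y. ((\<lambda>\<theta>. phase_sq (of_real r * cis \<theta>)) has_real_derivative y) (at t) \<and> y < 0"
    using Im_polylog_1_pos[OF z] by (intro exI conjI) (assumption, simp)
next
  show "continuous_on {\<theta>..\<phi>} (\<lambda>\<theta>. phase_sq (of_real r * cis \<theta>))"
    by (rule continuous_on_compose2[OF continuous_on_phase_sq])
       (use r in \<open>auto intro!: continuous_intros simp: norm_mult\<close>)
qed

subsection \<open>The dilogarithm on the coordinate axes\<close>

text \<open>Integrates a derivative bound, as \<open>g - f\<close> is nondecreasing. Derivatives are
  required only in the open interval, which admits derivatives written with a division by
  \<open>t\<close> on intervals starting at 0.\<close>

lemma DERIV_le_imp_le:
  fixes f g :: "real \<Rightarrow> real"
  assumes "a \<le> b"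
    and f: "\<And>t. a < t \<Longrightarrow> t < b \<Longrightarrow> (f has_real_derivative f' t) (at t)"
    and g: "\<And>t. a < t \<Longrightarrow> t < b \<Longrightarrow> (g has_real_derivative g' t) (at t)"
    and le: "\<And>t. a < t \<Longrightarrow> t < b \<Longrightarrow> f' t \<le> g' t"
    and cont: "continuous_on {a..b} f" "continuous_on {a..b} g"
    and "f a \<le> g a"
  shows "f b \<le> g b"
proof -
  have "g a - f a \<le> g b - f b"
  proof (rule DERIV_nonneg_imp_increasing_open[where f = "\<lambda>t. g t - f t", OF \<open>a \<le> b\<close>])
    fix t assume t: "a < t" "t < b"
    show "\<exists>y. ((\<lambda>t. g t - f t) has_real_derivative y) (at t) \<and> 0 \<le> y"
      using DERIV_diff[OF g[OF t] f[OF t]] le[OF t] by force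
  qed (intro continuous_intros cont)
  with \<open>f a \<le> g a\<close> show ?thesis by simp
qed

text \<open>On the imaginary axis Im Li_1 is the arctangent of \<open>t\<close>.\<close>

lemma has_real_derivative_Im_polylog_1_axis:
  assumes "0 \<le> t" "t < 1"
  shows "((\<lambda>t. Im (polylog 1 (of_real t * \<i>))) has_real_derivative 1 / (1 + t\<^sup>2)) (at t)"
proof -
  have n: "norm (of_real t * \<i>) < 1" using assms by (simp add: norm_mult)
  show ?thesis
    using has_real_derivative_polylog_ray(2)[OF n, of 0] unfolding ray_quotient(3)[OF n] by simp
qed

lemma continuous_on_Im_polylog_1_axis:
  assumes "r < 1"
  shows "continuous_on {0..r} (\<lambda>t. Im (polylog 1 (of_real t * \<i>)))"
proof (intro continuous_intros continuous_on_compose2[OF continuous_on_polylog[of 0, folded One_nat_def]])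
  show "(\<lambda>t. complex_of_real t * \<i>) ` {0..r} \<subseteq> ball 0 1"
    using assms by (auto simp: norm_mult)
qed

text \<open>Arctangent bounds by integrating from 0. The first two feed the estimates of Im Li_2;
  the third gives the monotonicity of Im Li_2 (\<i> r) / r.\<close>

lemma Im_polylog_1_axis_bounds:
  assumes r: "0 \<le> r" "r < 1"
  shows "Im (polylog 1 (of_real r * \<i>)) \<le> r"
    and "r - r ^ 3 / 3 \<le> Im (polylog 1 (of_real r * \<i>))"
    and "r / (1 + r\<^sup>2) \<le> Im (polylog 1 (of_real r * \<i>))"
proof -
  have pos: "1 + t\<^sup>2 > 0" for t :: real
    by (simp add: add_pos_nonneg)
  let ?c = "\<lambda>t. Im (polylog 1 (of_real t * \<i>))"
  have D: "(?c has_real_derivative 1 / (1 + t\<^sup>2)) (at t)" if "0 < t" "t < r" for t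
    using that r by (intro has_real_derivative_Im_polylog_1_axis) auto
  note cont = continuous_on_Im_polylog_1_axis[OF r(2)]
  show "?c r \<le> r"
    by (rule DERIV_le_imp_le[where g = "\<lambda>t. t" and g' = "\<lambda>_. 1", OF r(1) D _ _ cont])
       (use pos in \<open>auto intro!: continuous_intros simp: divide_le_eq\<close>)
  show "r - r ^ 3 / 3 \<le> ?c r"
  proof (rule DERIV_le_imp_le[where f = "\<lambda>t. t - t ^ 3 / 3" and f' = "\<lambda>t. 1 - t\<^sup>2", OF r(1) _ D _ _ cont])
    show "1 - t\<^sup>2 \<le> 1 / (1 + t\<^sup>2)" for t :: real
      using pos[of t] by (simp add: field_simps)
  qed (auto intro!: continuous_intros derivative_eq_intros)
  show "r / (1 + r\<^sup>2) \<le> ?c r"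
  proof (rule DERIV_le_imp_le[where f = "\<lambda>t. t / (1 + t\<^sup>2)" and f' = "\<lambda>t. (1 - t\<^sup>2) / (1 + t\<^sup>2)\<^sup>2",
        OF r(1) _ D _ _ cont])
    show "((\<lambda>t. t / (1 + t\<^sup>2)) has_real_derivative (1 - t\<^sup>2) / (1 + t\<^sup>2)\<^sup>2) (at t)" for t :: real
      using pos[of t] by (auto intro!: derivative_eq_intros simp: power2_eq_square)
    show "(1 - t\<^sup>2) / (1 + t\<^sup>2)\<^sup>2 \<le> 1 / (1 + t\<^sup>2)" for t :: real
    proof -
      have "(1 - t\<^sup>2) / (1 + t\<^sup>2)\<^sup>2 \<le> (1 + t\<^sup>2) / (1 + t\<^sup>2)\<^sup>2"
        by (intro divide_right_mono) auto
      then show ?thesis using pos[of t] by (simp add: power2_eq_square)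
    qed
    show "continuous_on {0..r} (\<lambda>t. t / (1 + t\<^sup>2))"
      using pos by (intro continuous_intros) (auto simp: less_le)
  qed auto
qed

lemma continuous_on_Li2_axis: "continuous_on {0..1} (\<lambda>t. Li2 (of_real t * \<i>))"
  by (rule continuous_on_compose2[OF continuous_on_Li2])
     (auto intro!: continuous_intros simp: norm_mult)

lemma has_real_derivative_Im_Li2_axis:
  assumes "0 < t" "t < 1"
  shows "((\<lambda>t. Im (Li2 (of_real t * \<i>))) has_real_derivative Im (polylog 1 (of_real t * \<i>)) / t) (at t)"
proof -
  have n: "norm (of_real t * \<i>) < 1" using assms by (simp add: norm_mult)
  have "Im (\<i> * polylog_quot 1 (of_real t * \<i>)) = Im (polylog 1 (of_real t * \<i>)) / t"
    using polylog_ray(2)[of t \<i> 1] assms(1) by (simp add: field_simps)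
  then have D: "((\<lambda>t. Im (polylog 2 (of_real t * \<i>))) has_real_derivative Im (polylog 1 (of_real t * \<i>)) / t) (at t)"
    using has_real_derivative_polylog_ray(2)[OF n, of 1] unfolding Suc_1 by simp
  show ?thesis
    by (rule has_field_derivative_transform_within_open[OF D, of "{0<..<1}"])
       (use assms in \<open>auto simp: Li2_conv_polylog norm_mult\<close>)
qed

text \<open>Im Li_2 (\<i> r) is the inverse tangent integral; its derivative arctan t / t lies
  between 1 - t^2 / 3 and 1.\<close>

lemma Im_Li2_axis_bounds:
  assumes r: "0 \<le> r" "r \<le> 1"
  shows "Im (Li2 (of_real r * \<i>)) \<le> r"
    and "r - r ^ 3 / 9 \<le> Im (Li2 (of_real r * \<i>))"
proof -
  let ?b = "\<lambda>t. Im (Li2 (of_real t * \<i>))"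
  let ?b' = "\<lambda>t. Im (polylog 1 (of_real t * \<i>)) / t"
  have D: "(?b has_real_derivative ?b' t) (at t)" if "0 < t" "t < r" for t
    using that r by (intro has_real_derivative_Im_Li2_axis) auto
  have cont: "continuous_on {0..r} ?b"
    using r by (intro continuous_intros continuous_on_subset[OF continuous_on_Li2_axis]) auto
  have B: "?b' t \<le> 1" "1 - t\<^sup>2 / 3 \<le> ?b' t" if "0 < t" "t < r" for t
    using Im_polylog_1_axis_bounds(1,2)[of t] that r
    by (auto simp: field_simps power2_eq_square power3_eq_cube)
  show "?b r \<le> r"
    by (rule DERIV_le_imp_le[where g = "\<lambda>t. t" and g' = "\<lambda>_. 1", OF r(1) D _ _ cont])
       (use B in \<open>auto intro!: continuous_intros\<close>)
  show "r - r ^ 3 / 9 \<le> ?b r"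
    by (rule DERIV_le_imp_le[where f = "\<lambda>t. t - t ^ 3 / 9" and f' = "\<lambda>t. 1 - t\<^sup>2 / 3", OF r(1) _ D _ _ cont])
       (use B in \<open>auto intro!: continuous_intros derivative_eq_intros\<close>)
qed

text \<open>Both sides vanish at 0 and the derivatives satisfy 1 / (1 + t^2) \<le> arctan t / t. The
  difference of the two sides is the numerator of the derivative of Im Li_2 (\<i> t) / t.\<close>

lemma Im_polylog_1_axis_le_Im_Li2:
  assumes r: "0 \<le> r" "r < 1"
  shows "Im (polylog 1 (of_real r * \<i>)) \<le> Im (Li2 (of_real r * \<i>))"
proof (rule DERIV_le_imp_le[where f = "\<lambda>r. Im (polylog 1 (of_real r * \<i>))" and g = "\<lambda>r. Im (Li2 (of_real r * \<i>))", OF r(1)])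
  fix t assume t: "0 < t" "t < r"
  show "1 / (1 + t\<^sup>2) \<le> Im (polylog 1 (of_real t * \<i>)) / t"
    using Im_polylog_1_axis_bounds(3)[of t] t r by (simp add: field_simps)
  show "((\<lambda>t. Im (polylog 1 (of_real t * \<i>))) has_real_derivative 1 / (1 + t\<^sup>2)) (at t)"
    using t r by (intro has_real_derivative_Im_polylog_1_axis) auto
  show "((\<lambda>t. Im (Li2 (of_real t * \<i>))) has_real_derivative Im (polylog 1 (of_real t * \<i>)) / t) (at t)"
    using t r by (intro has_real_derivative_Im_Li2_axis) auto
next
  show "continuous_on {0..r} (\<lambda>t. Im (Li2 (of_real t * \<i>)))"
    using r by (intro continuous_intros continuous_on_subset[OF continuous_on_Li2_axis]) auto
qed (use r continuous_on_Im_polylog_1_axis in auto)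

lemma Im_Li2_axis_quotient_antimono:
  assumes "0 < r" "r \<le> s" "s \<le> 1"
  shows "Im (Li2 (of_real s * \<i>)) / s \<le> Im (Li2 (of_real r * \<i>)) / r"
proof (rule DERIV_nonpos_imp_decreasing_open[where f = "\<lambda>t. Im (Li2 (of_real t * \<i>)) / t", OF assms(2)])
  let ?b = "\<lambda>t. Im (Li2 (of_real t * \<i>))"
  fix t assume "r < t" "t < s"
  then have t: "0 < t" "t < 1" using assms by auto
  have "((\<lambda>t. ?b t / t) has_real_derivative (Im (polylog 1 (of_real t * \<i>)) - ?b t) / t\<^sup>2) (at t)"
    using DERIV_divide[OF has_real_derivative_Im_Li2_axis[OF t] DERIV_ident] t
    by (simp add: power2_eq_square)
  moreover have "(Im (polylog 1 (of_real t * \<i>)) - ?b t) / t\<^sup>2 \<le> 0"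
    using Im_polylog_1_axis_le_Im_Li2[of t] t by (intro divide_nonpos_nonneg) auto
  ultimately show "\<exists>y. ((\<lambda>t. ?b t / t) has_real_derivative y) (at t) \<and> y \<le> 0"
    by blast
next
  show "continuous_on {r..s} (\<lambda>t. Im (Li2 (of_real t * \<i>)) / t)"
    using assms by (intro continuous_intros continuous_on_subset[OF continuous_on_Li2_axis]) auto
qed

section \<open>Series on the real axis and real parts on the imaginary axis\<close>

lemma Re_Li2_of_real_quotient_sums:
  assumes "\<bar>x\<bar> \<le> 1" "x \<noteq> 0"
  shows "(\<lambda>n. x ^ n / real (Suc n) ^ 2) sums (Re (Li2 (of_real x)) / x)"
proof -
  have "(\<lambda>n. complex_of_real x ^ Suc n / of_nat (Suc n) ^ 2) sums Li2 (of_real x)"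
    using assms by (intro Li2_sums) auto
  also have "(\<lambda>n. complex_of_real x ^ Suc n / of_nat (Suc n) ^ 2)
      = (\<lambda>n. of_real (x ^ Suc n / real (Suc n) ^ 2))"
    by simp
  finally have "(\<lambda>n. x ^ Suc n / real (Suc n) ^ 2) sums Re (Li2 (of_real x))"
    unfolding sums_complex_iff by (simp del: of_nat_Suc power_Suc)
  then have "(\<lambda>n. x ^ Suc n / real (Suc n) ^ 2 / x) sums (Re (Li2 (of_real x)) / x)"
    by (rule sums_divide)
  then show ?thesis using assms(2) by (simp del: of_nat_Suc)
qed

lemma Re_Li2_odd_part_sums:
  assumes "\<bar>x\<bar> \<le> 1" "x \<noteq> 0"
  shows "(\<lambda>n. (x ^ n + (- x) ^ n) / real (Suc n) ^ 2) sums
     ((Re (Li2 (of_real x)) - Re (Li2 (of_real (- x)))) / x)"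
  using sums_add[OF Re_Li2_of_real_quotient_sums[OF assms] Re_Li2_of_real_quotient_sums[of "- x"]] assms
  by (simp add: add_divide_distrib diff_divide_distrib)

text \<open>Both quotients are power series with nonnegative coefficients, so they are compared term
  by term, and the constant terms 1 and 2 bound them below.\<close>

lemma Re_Li2_quotient_mono:
  assumes "0 < x" "x \<le> y" "y \<le> 1"
  shows "1 \<le> Re (Li2 (of_real x)) / x"
    and "Re (Li2 (of_real x)) / x \<le> Re (Li2 (of_real y)) / y"
    and "2 \<le> (Re (Li2 (of_real x)) - Re (Li2 (of_real (- x)))) / x"
    and "(Re (Li2 (of_real x)) - Re (Li2 (of_real (- x)))) / x
         \<le> (Re (Li2 (of_real y)) - Re (Li2 (of_real (- y)))) / y"
proof -
  have "\<bar>x\<bar> \<le> 1" "x \<noteq> 0" "\<bar>y\<bar> \<le> 1" "y \<noteq> 0"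
    using assms by auto
  note x = Re_Li2_of_real_quotient_sums[OF this(1,2)] Re_Li2_odd_part_sums[OF this(1,2)]
    and y = Re_Li2_of_real_quotient_sums[OF this(3,4)] Re_Li2_odd_part_sums[OF this(3,4)]
  have even: "t ^ n + (- t) ^ n = (if even n then 2 * t ^ n else 0)" for t :: real and n
    by auto
  have "(\<Sum>n\<in>{0}. x ^ n / real (Suc n) ^ 2) \<le> Re (Li2 (of_real x)) / x"
    using sum_le_suminf[OF sums_summable[OF x(1)], of "{0}"] sums_unique[OF x(1)] assms by simp
  then show "1 \<le> Re (Li2 (of_real x)) / x" by simp
  have "(\<Sum>n\<in>{0}. (x ^ n + (- x) ^ n) / real (Suc n) ^ 2)
      \<le> (Re (Li2 (of_real x)) - Re (Li2 (of_real (- x)))) / x"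
    using sum_le_suminf[OF sums_summable[OF x(2)], of "{0}"] sums_unique[OF x(2)] assms by (simp add: even)
  then show "2 \<le> (Re (Li2 (of_real x)) - Re (Li2 (of_real (- x)))) / x" by simp
  show "Re (Li2 (of_real x)) / x \<le> Re (Li2 (of_real y)) / y"
    by (rule sums_le[OF _ x(1) y(1)]) (use assms in \<open>auto intro!: divide_right_mono power_mono\<close>)
  show "(Re (Li2 (of_real x)) - Re (Li2 (of_real (- x)))) / x
         \<le> (Re (Li2 (of_real y)) - Re (Li2 (of_real (- y)))) / y"
    by (rule sums_le[OF _ x(2) y(2)])
       (use assms in \<open>auto simp: even intro!: divide_right_mono power_mono\<close>)
qed

text \<open>The duplication formula at \<i> r: the points \<i> r and - \<i> r are conjugate, so the
  left side of the formula is twice the real part.\<close>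

lemma Re_Li2_axis:
  assumes "\<bar>r\<bar> \<le> 1"
  shows "Re (Li2 (of_real r * \<i>)) = Re (Li2 (of_real (- (r\<^sup>2)))) / 4"
proof -
  have n: "norm (of_real r * \<i>) \<le> 1"
    using assms by (simp add: norm_mult)
  have "Re (Li2 (of_real r * \<i>) + Li2 (- (of_real r * \<i>))) = Re (Li2 (of_real (- (r\<^sup>2)))) / 2"
    unfolding Li2_square[OF n] by (simp add: power_mult_distrib)
  moreover have "Li2 (- (of_real r * \<i>)) = cnj (Li2 (of_real r * \<i>))"
    using Li2_cnj[OF n] by simp
  ultimately show ?thesis by simp
qed

lemma phase_sq_of_real:
  assumes "0 \<le> x" "x \<le> 1"
  shows "phase_sq (of_real x) = 2 * Re (Li2 (of_real x))"
proof -
  have "Re (Li2 (of_real x)) \<ge> 0"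
  proof (cases "x = 0")
    case False
    then show ?thesis
      using Re_Li2_quotient_mono(1)[of x x] assms by (simp add: field_simps)
  qed simp
  then show ?thesis
    using assms by (simp add: phase_sq_def norm_complex_def)
qed

text \<open>The constant is (1/9)(\<pi>^2 / 3), the bound for all phases other than 1, 2 and 4. Here
  Im Li_2 \<ge> 8 r / 9, while Re Li_2 \<ge> - r \<pi>^2 / 24.\<close>

lemma phase_sq_axis_gt:
  assumes "0 < r" "r \<le> 1"
  shows "phase_sq (of_real r * \<i>) > r * (pi\<^sup>2 / 27)"
proof -
  have "r ^ 2 \<le> 1 ^ 2" using assms by (intro power_mono) auto
  then have r2: "r * r\<^sup>2 \<le> r * 1" "r\<^sup>2 \<le> r * 1"
    unfolding power2_eq_square using assms by (auto intro!: mult_left_mono)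
  have "\<bar>Re (Li2 (of_real (- (r\<^sup>2))))\<bar> \<le> r\<^sup>2 * (pi\<^sup>2 / 6)"
    using norm_Li2_le[of "of_real (- (r\<^sup>2))"] abs_Re_le_cmod[of "Li2 (of_real (- (r\<^sup>2)))"] \<open>r ^ 2 \<le> 1 ^ 2\<close>
    by (simp add: norm_power)
  also have "\<dots> \<le> r * (pi\<^sup>2 / 6)"
    using r2 by (intro mult_right_mono) auto
  finally have a: "Re (Li2 (of_real r * \<i>)) \<ge> - (r * (pi\<^sup>2 / 24))"
    using assms by (simp add: Re_Li2_axis abs_le_iff)
  have "r * (8 / 9) \<le> r - r ^ 3 / 9"
    using r2 by (simp add: power3_eq_cube power2_eq_square)
  also have "\<dots> \<le> Im (Li2 (of_real r * \<i>))"
    using Im_Li2_axis_bounds assms by simp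
  also have "\<dots> \<le> norm (Li2 (of_real r * \<i>))"
    using abs_Im_le_cmod[of "Li2 (of_real r * \<i>)"] by simp
  finally have "phase_sq (of_real r * \<i>) \<ge> r * (8 / 9 - pi\<^sup>2 / 24)"
    using a by (simp add: phase_sq_def algebra_simps)
  \<comment> \<open>The comparison needs \<pi>^2 < 192 / 17, which is about 11.29.\<close>
  moreover have "pi\<^sup>2 < (16 / 5)\<^sup>2"
    using pi_less_4 pi_approx by (intro power_strict_mono) auto
  then have "r * (pi\<^sup>2 / 27) < r * (8 / 9 - pi\<^sup>2 / 24)"
    using assms by (intro mult_strict_left_mono) (auto simp: power2_eq_square)
  ultimately show ?thesis by linarith
qed

subsection \<open>Angular monotonicity and the critical radius\<close>

lemma of_real_cis_arccos:
  assumes "z \<noteq> 0" "Im z \<ge> 0"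
  shows "of_real (norm z) * cis (arccos (Re z / norm z)) = z"
proof -
  have b: "- 1 \<le> Re z / norm z" "Re z / norm z \<le> 1"
    using assms abs_Re_le_cmod[of z] by (auto simp: field_simps abs_le_iff)
  have "(norm z * sin (arccos (Re z / norm z)))\<^sup>2 = (norm z)\<^sup>2 * (1 - (Re z / norm z)\<^sup>2)"
    using b by (simp add: power_mult_distrib sin_squared_eq)
  also have "\<dots> = (norm z)\<^sup>2 - (Re z)\<^sup>2"
    using assms by (simp add: power_divide right_diff_distrib)
  also have "\<dots> = (Im z)\<^sup>2"
    by (simp add: cmod_power2)
  finally have "(norm z * sin (arccos (Re z / norm z)))\<^sup>2 = (Im z)\<^sup>2" .
  moreover have "sin (arccos (Re z / norm z)) \<ge> 0"
    using b by (intro sin_ge_zero arccos_lbound arccos_ubound)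
  ultimately have "norm z * sin (arccos (Re z / norm z)) = Im z"
    using assms by (simp add: power2_eq_iff_nonneg)
  then show ?thesis
    using assms b by (simp add: complex_eq_iff)
qed

text \<open>Conjugation moves both points to the closed upper half disc, where the angle is the
  arccosine of Re z / |z| and decreases as Re z grows.\<close>

lemma phase_sq_strict_mono_Re:
  assumes "norm z = norm w" "norm w < 1" "Re z < Re w"
  shows "phase_sq z < phase_sq w"
proof -
  have *: "phase_sq z < phase_sq w"
    if "norm z = norm w" "norm w < 1" "Re z < Re w" "Im z \<ge> 0" "Im w \<ge> 0" for z w
  proof -
    have nz: "z \<noteq> 0" "w \<noteq> 0"
      using that by auto
    have b: "\<bar>Re z / norm z\<bar> \<le> 1" "\<bar>Re w / norm w\<bar> \<le> 1"
      "- 1 \<le> Re z / norm z" "Re z / norm z \<le> 1" "- 1 \<le> Re w / norm w" "Re w / norm w \<le> 1"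
      using nz abs_Re_le_cmod[of z] abs_Re_le_cmod[of w] by (auto simp: field_simps abs_le_iff)
    have "Re z / norm z < Re w / norm w"
      using that nz by (simp add: divide_strict_right_mono)
    then have "arccos (Re w / norm w) < arccos (Re z / norm z)"
      using b by (simp add: arccos_less_mono)
    then have "phase_sq (of_real (norm z) * cis (arccos (Re z / norm z)))
        < phase_sq (of_real (norm z) * cis (arccos (Re w / norm w)))"
      using b nz that by (intro phase_sq_cis_strict_antimono arccos_lbound arccos_ubound) auto
    then show ?thesis
      using of_real_cis_arccos[of z] of_real_cis_arccos[of w] that nz by simp
  qed
  define up where "up z = (if Im z \<ge> 0 then z else cnj z)" for z
  have "phase_sq (up z) < phase_sq (up w)"
    by (rule *) (use assms in \<open>auto simp: up_def\<close>)
  then show ?thesis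
    using assms by (simp add: up_def phase_sq_cnj split: if_splits)
qed

lemma phase_sq_mono_Re:
  assumes "norm z = norm w" "norm w < 1" "Re z \<le> Re w"
  shows "phase_sq z \<le> phase_sq w"
proof (cases "Re z = Re w")
  case True
  have "(Im z)\<^sup>2 = (Im w)\<^sup>2"
    using assms(1) True by (simp add: norm_complex_def)
  then have "z = w \<or> z = cnj w"
    using True by (auto simp: complex_eq_iff power2_eq_iff)
  then show ?thesis
    using assms by (auto simp: phase_sq_cnj)
next
  case False
  then show ?thesis
    using phase_sq_strict_mono_Re[of z w] assms by simp
qed

section \<open>The gap between phases 1 and 4, and the critical radius\<close>

definition phase_gap :: "complex \<Rightarrow> real" where
  "phase_gap z = phase_sq z - phase_sq (- (z\<^sup>2)) / 4"

lemma phase_gap_cnj: "norm z \<le> 1 \<Longrightarrow> phase_gap (cnj z) = phase_gap z"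
  using phase_sq_cnj[of z] phase_sq_cnj[of "- (z\<^sup>2)"]
  by (simp add: phase_gap_def norm_power power_le_one)

lemma phase_gap_0 [simp]: "phase_gap 0 = 0"
  by (simp add: phase_gap_def phase_sq_def)

lemma continuous_on_phase_gap: "continuous_on (cball 0 1) phase_gap"
  unfolding phase_gap_def[abs_def]
  by (intro continuous_intros continuous_on_phase_sq continuous_on_compose2[OF continuous_on_phase_sq])
     (auto simp: norm_power power_le_one)

text \<open>On a circle Re (- z^2) = |z|^2 - 2 (Re z)^2, which decreases in Re z on the right half.
  The subtracted term thus shrinks while \<open>phase_sq z\<close> grows.\<close>

lemma phase_gap_strict_mono_Re:
  assumes "norm z = norm w" "norm w < 1" "0 \<le> Re z" "Re z < Re w"
  shows "phase_gap z < phase_gap w"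
proof -
  have sq: "Re (u\<^sup>2) = 2 * (Re u)\<^sup>2 - (norm u)\<^sup>2" for u
    unfolding cmod_power2 by (simp add: Re_power2)
  have "(Re z)\<^sup>2 < (Re w)\<^sup>2"
    using assms by (intro power_strict_mono) auto
  then have "phase_sq (- (w\<^sup>2)) \<le> phase_sq (- (z\<^sup>2))"
    using assms by (intro phase_sq_mono_Re) (auto simp: sq norm_power power_less_one_iff)
  moreover have "phase_sq z < phase_sq w"
    by (rule phase_sq_strict_mono_Re) (use assms in auto)
  ultimately show ?thesis
    by (simp add: phase_gap_def)
qed

text \<open>
  On the imaginary axis the gap has the sign of \<open>(b / r)\<^sup>2 - X (X - Y) / (4 r\<^sup>2)\<close>, where
  \<open>b = Im (Li2 (\<i> r))\<close>, \<open>X = Li2 (r\<^sup>2)\<close> and \<open>Y = Li2 (- r\<^sup>2) = 4 Re (Li2 (\<i> r))\<close>: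
  multiply \<open>|Li2 (\<i> r)| - (X / 2 - Y / 4)\<close> by the corresponding sum.
\<close>

definition axis_test :: "real \<Rightarrow> real" where
  "axis_test r = (Im (Li2 (of_real r * \<i>)) / r)\<^sup>2 -
     r\<^sup>2 * ((Re (Li2 (of_real (r\<^sup>2))) / r\<^sup>2) *
       ((Re (Li2 (of_real (r\<^sup>2))) - Re (Li2 (of_real (- (r\<^sup>2))))) / r\<^sup>2)) / 4"

lemma sgn_phase_gap_axis:
  assumes "0 < r" "r \<le> 1"
  shows "sgn (phase_gap (of_real r * \<i>)) = sgn (axis_test r)"
proof -
  define X where "X = Re (Li2 (of_real (r\<^sup>2)))"
  define Y where "Y = Re (Li2 (of_real (- (r\<^sup>2))))"
  define b where "b = Im (Li2 (of_real r * \<i>))"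
  define N where "N = norm (Li2 (of_real r * \<i>))"
  have r2: "0 < r\<^sup>2" "r\<^sup>2 \<le> 1"
    using assms by (auto simp: power_le_one)
  have "1 \<le> X / r\<^sup>2" "2 \<le> (X - Y) / r\<^sup>2"
    unfolding X_def Y_def using r2 by (intro Re_Li2_quotient_mono[of _ "r\<^sup>2"]; simp)+
  then have "r\<^sup>2 \<le> X" "2 * r\<^sup>2 \<le> X - Y"
    using assms by (simp_all add: le_divide_eq)
  then have pos: "X > 0" "X - Y > 0"
    using r2(1) by linarith+
  have Re: "Re (Li2 (of_real r * \<i>)) = Y / 4"
    using assms by (simp add: Re_Li2_axis Y_def)
  have N2: "N\<^sup>2 = (Y / 4)\<^sup>2 + b\<^sup>2"
    unfolding N_def cmod_power2 Re b_def by simp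
  \<comment> \<open>The gap is \<open>(N + Y / 4) - X / 2\<close>. Writing \<open>w\<close> as
    \<open>X / 4 + (X - Y) / 4\<close> shows that it is positive, so multiplying by
    \<open>N + w\<close> keeps the sign.\<close>
  define w where "w = X / 2 - Y / 4"
  have w: "N + w > 0"
    using pos by (simp add: w_def N_def add_nonneg_pos)
  have gap: "phase_gap (of_real r * \<i>) = N - w"
    using phase_sq_of_real[of "r\<^sup>2"] r2 Re
    by (simp add: phase_gap_def phase_sq_def[of "of_real r * \<i>"] power_mult_distrib N_def w_def X_def)
  have "(N - w) * (N + w) = N\<^sup>2 - w\<^sup>2"
    by (simp add: power2_eq_square algebra_simps)
  also have "\<dots> = b\<^sup>2 - X * (X - Y) / 4"
    unfolding N2 w_def by (simp add: power2_eq_square field_simps)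
  also have "\<dots> = r\<^sup>2 * axis_test r"
  proof -
    have axis: "axis_test r = b\<^sup>2 / r\<^sup>2 - r\<^sup>2 * ((X / r\<^sup>2) * ((X - Y) / r\<^sup>2)) / 4"
      unfolding axis_test_def X_def Y_def b_def power_divide ..
    have "b\<^sup>2 - X * (X - Y) / 4 = q * (b\<^sup>2 / q - q * ((X / q) * ((X - Y) / q)) / 4)"
      if "q \<noteq> 0" for q
      using that by (simp add: field_simps)
    from this[OF less_imp_neq[OF r2(1), symmetric]] show ?thesis
      unfolding axis .
  qed
  finally have "sgn ((N - w) * (N + w)) = sgn (r\<^sup>2 * axis_test r)"
    by simp
  moreover have "sgn (N + w) = 1" "sgn (r\<^sup>2) = 1"
    using w r2(1) by (simp_all only: sgn_pos)
  ultimately show ?thesis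
    unfolding gap sgn_mult by simp
qed

text \<open>The square is nonincreasing and the bracketed product is nondecreasing; strictness comes
  from the factor \<open>r\<^sup>2\<close> alone.\<close>

lemma axis_test_strict_antimono:
  assumes "0 < r" "r < s" "s \<le> 1"
  shows "axis_test s < axis_test r"
proof -
  have r2: "0 < r\<^sup>2" "r\<^sup>2 < s\<^sup>2" "s\<^sup>2 \<le> 1"
    using assms by (auto simp: power_le_one intro!: power_strict_mono)
  note M = Re_Li2_quotient_mono[OF r2(1) less_imp_le[OF r2(2)] r2(3)]
  have "s - s ^ 3 / 9 \<ge> 0"
  proof -
    have "s * s\<^sup>2 \<le> s * 1" using r2 assms by (intro mult_left_mono) auto
    then show ?thesis using assms by (simp add: power3_eq_cube power2_eq_square)
  qed
  then have "0 \<le> Im (Li2 (of_real s * \<i>)) / s"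
    using Im_Li2_axis_bounds(2)[of s] assms by simp
  then have 1: "(Im (Li2 (of_real s * \<i>)) / s)\<^sup>2 \<le> (Im (Li2 (of_real r * \<i>)) / r)\<^sup>2"
    using assms by (intro power_mono Im_Li2_axis_quotient_antimono) auto
  have 2: "r\<^sup>2 * ((Re (Li2 (of_real (r\<^sup>2))) / r\<^sup>2) *
       ((Re (Li2 (of_real (r\<^sup>2))) - Re (Li2 (of_real (- (r\<^sup>2))))) / r\<^sup>2))
     < s\<^sup>2 * ((Re (Li2 (of_real (s\<^sup>2))) / s\<^sup>2) *
       ((Re (Li2 (of_real (s\<^sup>2))) - Re (Li2 (of_real (- (s\<^sup>2))))) / s\<^sup>2))"
    by (rule mult_less_le_imp_less[OF r2(2) mult_mono[OF M(2) M(4)]])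
       (rule less_imp_le mult_pos_pos | use M r2(1) in linarith)+
  have "a - d / 4 < b - c / 4" if "a \<le> b" "c < d" for a b c d :: real
    using that by simp
  from this[OF 1 2] show ?thesis
    unfolding axis_test_def .
qed

text \<open>The threshold 4/9 is where the bound r^2 \<pi>^2 / 12 for the subtracted term meets the
  lower bound r \<pi>^2 / 27.\<close>

lemma phase_gap_axis_pos:
  assumes "0 < r" "r \<le> 4 / 9"
  shows "phase_gap (of_real r * \<i>) > 0"
proof -
  have "phase_sq (of_real (r\<^sup>2)) / 4 \<le> r\<^sup>2 * (pi\<^sup>2 / 3) / 4"
    using phase_sq_le[of "of_real (r\<^sup>2)"] assms by (simp add: norm_power power_le_one)
  also have "\<dots> \<le> r * (4 / 9) * (pi\<^sup>2 / 3) / 4"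
    using assms by (intro divide_right_mono mult_right_mono) (auto simp: power2_eq_square)
  also have "\<dots> = r * (pi\<^sup>2 / 27)" by simp
  also have "\<dots> < phase_sq (of_real r * \<i>)"
    using assms by (intro phase_sq_axis_gt) auto
  finally show ?thesis
    by (simp add: phase_gap_def power_mult_distrib)
qed

text \<open>At r = 1 one has \<open>Y = - X / 2\<close>, so the test value is (Im Li_2 \<i>)^2 - 3
  X^2 / 8. Since Im Li_2 \<i> \<le> 1, it suffices that X^2 > 8/3 for X = \<pi>^2 / 6.\<close>

lemma phase_gap_axis_1_neg: "phase_gap \<i> < 0"
proof -
  define X where "X = pi\<^sup>2 / 6"
  have X: "Re (Li2 1) = X" by (simp add: Li2_1 X_def)
  have Y: "Re (Li2 (-1)) = - (X / 2)"
    using arg_cong[OF Li2_square[of 1], of Re] by (simp add: X)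
  have "0 \<le> Im (Li2 \<i>)" "Im (Li2 \<i>) \<le> 1"
    using Im_Li2_axis_bounds[of 1] by auto
  then have "(Im (Li2 \<i>))\<^sup>2 \<le> 1"
    by (simp add: power_le_one)
  moreover have "3.14\<^sup>2 \<le> pi\<^sup>2"
    using pi_approx by (intro power_mono) auto
  then have "3.14\<^sup>2 / 6 \<le> X" by (simp add: X_def)
  then have "(3.14\<^sup>2 / 6) * (3.14\<^sup>2 / 6) \<le> X * X"
    by (intro mult_mono) (auto simp: X_def)
  then have "X * X > 8 / 3"
    by (rule less_le_trans[rotated]) (simp add: power2_eq_square)
  ultimately have "axis_test 1 < 0"
    by (simp add: axis_test_def X Y)
  then show ?thesis
    using sgn_phase_gap_axis[of 1] by (simp add: sgn_if split: if_splits)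
qed

text \<open>A zero exists by the intermediate value theorem; strict monotonicity of
  \<open>axis_test\<close> then fixes the sign on either side of it.\<close>

lemma phase_gap_axis_sign_change:
  obtains \<beta> where "0 < \<beta>" "\<beta> < 1"
    and "\<forall>r\<in>{0<..1}. sgn (phase_gap (of_real r * \<i>)) = sgn (\<beta> - r)"
proof -
  have "continuous_on {4/9..1} (\<lambda>r. phase_gap (of_real r * \<i>))"
    by (rule continuous_on_compose2[OF continuous_on_phase_gap])
       (auto intro!: continuous_intros simp: norm_mult)
  then obtain \<beta> where \<beta>: "4/9 \<le> \<beta>" "\<beta> \<le> 1" "phase_gap (of_real \<beta> * \<i>) = 0"
    using IVT2'[of "\<lambda>r. phase_gap (of_real r * \<i>)" 1 0 "4/9"]
      phase_gap_axis_1_neg phase_gap_axis_pos[of "4/9"] by auto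
  have zero: "axis_test \<beta> = 0"
    using sgn_phase_gap_axis[of \<beta>] \<beta> by (simp add: sgn_0_0)
  show ?thesis
  proof
    show "0 < \<beta>" using \<beta> by simp
    show "\<beta> < 1" using \<beta> phase_gap_axis_1_neg by (cases "\<beta> = 1") auto
    show "\<forall>r\<in>{0<..1}. sgn (phase_gap (of_real r * \<i>)) = sgn (\<beta> - r)"
    proof
      fix r :: real assume "r \<in> {0<..1}"
      then have r: "0 < r" "r \<le> 1" by auto
      have "sgn (axis_test r) = sgn (\<beta> - r)"
        using axis_test_strict_antimono[of r \<beta>] axis_test_strict_antimono[of \<beta> r] zero r \<beta>
        by (cases r \<beta> rule: linorder_cases) auto
      then show "sgn (phase_gap (of_real r * \<i>)) = sgn (\<beta> - r)"
        using sgn_phase_gap_axis[OF r] by simp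
    qed
  qed
qed

subsection \<open>The phases and their regions\<close>

lemma g_phase_1: "g_phase 1 z = sqrt (phase_sq z / 2)"
  by (simp add: g_phase_def f_phase_conv)

lemma g_phase_2: "g_phase 2 z = sqrt (phase_sq (- z) / 2)"
  by (simp add: g_phase_def f_phase_conv)

text \<open>Brings \<open>g_phase 4\<close> to the same shape as \<open>g_phase 1\<close>, so that
  comparing phases means comparing radicands.\<close>

lemma sqrt_half_div_2: "sqrt (x / 2) / 2 = sqrt (x / 4 / 2)"
  by (simp only: real_sqrt_divide real_sqrt_four) simp

lemma g_phase_4: "g_phase 4 z = sqrt (phase_sq (- (z\<^sup>2)) / 4 / 2)"
  unfolding sqrt_half_div_2[symmetric] by (simp add: g_phase_def f_phase_conv)

text \<open>Every such index has the form k or 2k with divisor and exponent k \<ge> 3. The divisor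
  contributes 1/9 after squaring, and |z|^k \<le> |z|.\<close>

lemma g_phase_le:
  assumes "norm z < 1" "l \<ge> 1" "l \<notin> {1, 2, 4}"
  shows "g_phase l z \<le> sqrt (norm z * (pi\<^sup>2 / 27) / 2)"
proof -
  have *: "sqrt (phase_sq w / 2) / real k \<le> sqrt (norm z * (pi\<^sup>2 / 27) / 2)"
    if "k \<ge> 3" "norm w = norm z ^ k" for w k
  proof -
    have "norm w \<le> norm z"
      using that assms power_decreasing[of 1 k "norm z"] by simp
    have "phase_sq w \<le> norm w * (pi\<^sup>2 / 3)"
      using \<open>norm w \<le> norm z\<close> assms by (intro phase_sq_le) auto
    also have "\<dots> \<le> norm z * (pi\<^sup>2 / 3)"
      using \<open>norm w \<le> norm z\<close> by (intro mult_right_mono) auto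
    finally have "phase_sq w / 9 / 2 \<le> norm z * (pi\<^sup>2 / 27) / 2"
      by simp
    then have "sqrt (phase_sq w / 9 / 2) \<le> sqrt (norm z * (pi\<^sup>2 / 27) / 2)"
      by (rule real_sqrt_le_mono)
    moreover have "sqrt (phase_sq w / 9 / 2) = sqrt (phase_sq w / 2) / 3"
    proof -
      have "sqrt 9 = (3 :: real)"
        using real_sqrt_abs[of 3] by simp
      then show ?thesis by (simp only: real_sqrt_divide) simp
    qed
    moreover have "sqrt (phase_sq w / 2) / real k \<le> sqrt (phase_sq w / 2) / 3"
      using that phase_sq_nonneg[of w] by (intro divide_left_mono) auto
    ultimately show ?thesis by linarith
  qed
  show ?thesis
  proof (cases "odd l")
    case True
    have "l \<noteq> 1" using assms(3) by auto
    then have "l \<ge> 3" using True assms(2) by presburger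
    then show ?thesis
      using True *[of l "z ^ l"] by (simp add: g_phase_def f_phase_conv norm_power)
  next
    case False
    then have "l div 2 \<ge> 3" using assms(2,3) by auto
    then show ?thesis
      using False *[of "l div 2" "- (z ^ (l div 2))"] by (simp add: g_phase_def f_phase_conv norm_power)
  qed
qed

text \<open>One of z and -z has nonnegative real part, and there \<open>phase_sq\<close> is at least
  its value at \<i> |z|, which beats the common bound.\<close>

lemma g_phase_less_max:
  assumes "z \<noteq> 0" "norm z < 1" "l \<ge> 1" "l \<notin> {1, 2, 4}"
  shows "g_phase l z < g_phase 1 z \<or> g_phase l z < g_phase 2 z"
proof -
  have *: "norm z * (pi\<^sup>2 / 27) < phase_sq w" if "norm w = norm z" "Re w \<ge> 0" for w
  proof -
    have "norm z * (pi\<^sup>2 / 27) < phase_sq (of_real (norm z) * \<i>)"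
      using assms by (intro phase_sq_axis_gt) auto
    also have "\<dots> \<le> phase_sq w"
      using that assms by (intro phase_sq_mono_Re) (auto simp: norm_mult)
    finally show ?thesis .
  qed
  have "norm z * (pi\<^sup>2 / 27) < phase_sq z \<or> norm z * (pi\<^sup>2 / 27) < phase_sq (- z)"
    using *[of z] *[of "- z"] by fastforce
  then have "sqrt (norm z * (pi\<^sup>2 / 27) / 2) < g_phase 1 z \<or> sqrt (norm z * (pi\<^sup>2 / 27) / 2) < g_phase 2 z"
    unfolding g_phase_1 g_phase_2 by simp
  then show ?thesis
    using g_phase_le[OF assms(2-4)] by linarith
qed

lemma R_phase_empty:
  assumes "l \<ge> 1" "l \<notin> {1, 2, 4}"
  shows "R_phase l = {}"
proof -
  have False if "z \<in> R_phase l" for z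
  proof -
    have "g_phase 1 z < g_phase l z" "g_phase 2 z < g_phase l z"
      using that assms by (auto simp: R_phase_def)
    moreover have "z \<noteq> 0" "norm z < 1"
      using that by (auto simp: R_phase_def)
    ultimately show False
      using g_phase_less_max[OF _ _ assms] by fastforce
  qed
  then show ?thesis by blast
qed

text \<open>All other phases lie below phase 1 or phase 2, so the infinitely many conditions reduce
  to two.\<close>

lemma mem_R_phase_iff:
  assumes "m = 1 \<or> m = 2 \<or> m = 4"
  shows "z \<in> R_phase m \<longleftrightarrow> z \<noteq> 0 \<and> norm z < 1 \<and> (m \<noteq> 1 \<longrightarrow> g_phase 1 z < g_phase m z) \<and>
     (m \<noteq> 2 \<longrightarrow> g_phase 2 z < g_phase m z) \<and> (m \<noteq> 4 \<longrightarrow> g_phase 4 z < g_phase m z)"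
    (is "_ \<longleftrightarrow> ?rhs")
proof
  assume "z \<in> R_phase m"
  then have "z \<noteq> 0" "norm z < 1" and *: "\<And>l. l \<ge> 1 \<Longrightarrow> l \<noteq> m \<Longrightarrow> g_phase l z < g_phase m z"
    by (auto simp: R_phase_def)
  then show ?rhs
    using *[of 1] *[of 2] *[of 4] by auto
next
  assume z: ?rhs
  have "g_phase l z < g_phase m z" if "l \<ge> 1" "l \<noteq> m" for l
  proof (cases "l \<in> {1, 2, 4}")
    case True
    then show ?thesis using z that by auto
  next
    case False
    then have "g_phase l z < g_phase 1 z \<or> g_phase l z < g_phase 2 z"
      using g_phase_less_max[of z l] z that by blast
    moreover have "g_phase 1 z \<le> g_phase m z" "g_phase 2 z \<le> g_phase m z"
      using z by (cases "m = 1"; force)+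
    ultimately show ?thesis by linarith
  qed
  then show "z \<in> R_phase m"
    using z by (auto simp: R_phase_def)
qed

lemma phase_gap_minus: "phase_gap (- z) = phase_sq (- z) - phase_sq (- (z\<^sup>2)) / 4"
  by (simp add: phase_gap_def)

lemma R_phase_1: "R_phase 1 = {z \<in> ball 0 1. 0 < Re z \<and> 0 < phase_gap z}"
proof -
  have "phase_sq (- z) < phase_sq z \<longleftrightarrow> 0 < Re z" if "norm z < 1" for z
    using phase_sq_strict_mono_Re[of "- z" z] phase_sq_mono_Re[of z "- z"] that
    by fastforce
  then show ?thesis
    by (auto simp: mem_R_phase_iff g_phase_1[unfolded One_nat_def] g_phase_2 g_phase_4 phase_gap_def)
qed

lemma mem_uminus_image_iff: "z \<in> uminus ` S \<longleftrightarrow> - z \<in> S" for z :: "'a::group_add"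
  using image_eqI[of z uminus "- z" S] by auto

text \<open>The map z \<mapsto> -z exchanges phases 1 and 2 and fixes phase 4.\<close>

lemma R_phase_2: "R_phase 2 = uminus ` R_phase 1"
proof -
  have "z \<in> R_phase 2 \<longleftrightarrow> - z \<in> R_phase 1" for z
    by (auto simp: mem_R_phase_iff g_phase_1[unfolded One_nat_def] g_phase_2 g_phase_4)
  then show ?thesis
    by (intro set_eqI) (simp only: mem_uminus_image_iff)
qed

lemma R_phase_4: "R_phase 4 = {z \<in> ball 0 1. phase_gap z < 0 \<and> phase_gap (- z) < 0}"
  unfolding phase_gap_minus
  by (auto simp: mem_R_phase_iff g_phase_1[unfolded One_nat_def] g_phase_2 g_phase_4 phase_gap_def phase_sq_def)

lemma uminus_R_phase_4: "uminus ` R_phase 4 = R_phase 4"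
proof -
  have "z \<in> R_phase 4 \<longleftrightarrow> - z \<in> R_phase 4" for z
    by (auto simp: R_phase_4)
  then show ?thesis
    by (intro set_eqI) (simp only: mem_uminus_image_iff)
qed

lemma frontier_uminus:
  fixes S :: "'a::euclidean_space set"
  shows "frontier (uminus ` S) = uminus ` frontier S"
proof -
  have "closure (uminus ` S) = uminus ` closure S"
    using closure_scaleR[of "- 1" S] by simp
  then show ?thesis
    by (simp add: frontier_def interior_negations image_set_diff)
qed

text \<open>Since - (\<i> r)^2 = r^2, the value f_2(r) is phase 4 at \<i> r.\<close>

lemma is_beta_iff: "is_beta r \<longleftrightarrow> 0 < r \<and> r \<le> 1 \<and> phase_gap (of_real r * \<i>) = 0"
proof -
  have "f_phase 1 (\<i> * of_real r) = f_phase 2 (of_real r)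
      \<longleftrightarrow> sqrt (phase_sq (of_real r * \<i>) / 2) = sqrt (phase_sq ((of_real r)\<^sup>2) / 4 / 2)"
    unfolding sqrt_half_div_2[symmetric] by (simp add: f_phase_conv mult.commute)
  also have "\<dots> \<longleftrightarrow> phase_gap (of_real r * \<i>) = 0"
    by (simp only: real_sqrt_eq_iff) (auto simp: phase_gap_def power_mult_distrib)
  finally show ?thesis by (auto simp: is_beta_def)
qed

text \<open>The curve \<gamma> together with its conjugate, so that the boundary arguments need no
  condition on Im z.\<close>

definition gamma_right :: "complex set" where
  "gamma_right = {z \<in> ball 0 1 - {0}. 0 \<le> Re z \<and> phase_gap z = 0}"

lemma gamma_curve_conv: "gamma_curve = {z \<in> gamma_right. 0 \<le> Im z}"
  by (auto simp: gamma_curve_def gamma_right_def g_phase_1[unfolded One_nat_def] g_phase_4 phase_gap_def)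

lemma gamma_right_conv: "gamma_right = gamma_curve \<union> cnj ` gamma_curve"
proof -
  have cnj: "cnj z \<in> gamma_right" if "z \<in> gamma_right" for z
    using that by (auto simp: gamma_right_def phase_gap_cnj)
  have "z \<in> cnj ` {z \<in> gamma_right. 0 \<le> Im z}" if "z \<in> gamma_right" "\<not> 0 \<le> Im z" for z
    using cnj[OF that(1)] that(2) by (intro image_eqI[of _ _ "cnj z"]) auto
  then show ?thesis
    unfolding gamma_curve_conv using cnj by blast
qed

lemma uminus_gamma_right_conv:
  "uminus ` gamma_right = uminus ` gamma_curve \<union> (\<lambda>z. - cnj z) ` gamma_curve"
  by (simp add: gamma_right_conv image_Un image_image)

lemma imag_seg_conv:
  assumes "0 < \<beta>"
  shows "imag_seg 0 \<beta> \<union> imag_seg (- \<beta>) 0 = {z. Re z = 0 \<and> norm z \<le> \<beta>}"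
proof (intro subset_antisym subsetI)
  fix z assume "z \<in> {z. Re z = 0 \<and> norm z \<le> \<beta>}"
  then have "z = \<i> * of_real (Im z)" "\<bar>Im z\<bar> \<le> \<beta>"
    by (auto simp: complex_eq_iff norm_complex_def)
  then show "z \<in> imag_seg 0 \<beta> \<union> imag_seg (- \<beta>) 0"
    unfolding imag_seg_def by (cases "Im z \<ge> 0") (auto intro: image_eqI[of _ _ "Im z"])
qed (auto simp: imag_seg_def norm_mult)

text \<open>Allows a small change of Re z along the circle through z, where the gap is strictly
  monotone. The sign \<open>\<sigma>\<close> selects the half circle containing z.\<close>

lemma nearby_same_norm:
  fixes z :: complex
  assumes "e > 0"
  obtains d where "d > 0"
    "\<And>x. \<bar>x - Re z\<bar> < d \<Longrightarrow> \<bar>x\<bar> \<le> norm z \<Longrightarrow> \<exists>w. norm w = norm z \<and> Re w = x \<and> dist w z < e"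
proof -
  define \<sigma> :: real where "\<sigma> = (if Im z \<ge> 0 then 1 else - 1)"
  define p where "p x = Complex x (\<sigma> * sqrt ((norm z)\<^sup>2 - x\<^sup>2))" for x
  have p: "p (Re z) = z"
    by (simp add: p_def \<sigma>_def cmod_power2 complex_eq_iff)
  have norm_p: "norm (p x) = norm z" if "\<bar>x\<bar> \<le> norm z" for x
  proof -
    have "x\<^sup>2 \<le> (norm z)\<^sup>2"
      using that by (metis abs_le_square_iff abs_norm_cancel)
    then show ?thesis
      by (simp add: p_def norm_complex_def[of "Complex _ _"] power_mult_distrib \<sigma>_def)
  qed
  have "continuous_on UNIV p"
    unfolding p_def[abs_def] Complex_eq by (intro continuous_intros)
  then obtain d where "d > 0" "\<And>x. dist x (Re z) < d \<Longrightarrow> dist (p x) (p (Re z)) < e"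
    using assms unfolding continuous_on_iff by (meson UNIV_I)
  then show ?thesis
    using that[of d] norm_p p by (auto simp: dist_real_def) (metis complex.sel(1) p_def)
qed

subsection \<open>Boundaries of the regions\<close>

text \<open>The first series term gives \<open>phase_sq\<close> \<ge> 2 r, whereas the subtracted
  term is at most 4 r / 3 already by \<pi> < 4.\<close>

lemma phase_gap_of_real_pos:
  assumes "0 < r" "r < 1"
  shows "phase_gap (of_real r) > 0"
proof -
  have "phase_sq (- (of_real r)\<^sup>2) / 4 \<le> r\<^sup>2 * (pi\<^sup>2 / 3) / 4"
    using phase_sq_le[of "- (of_real r)\<^sup>2"] assms by (simp add: norm_power power_le_one)
  also have "\<dots> \<le> r * (4\<^sup>2 / 3) / 4"
    using assms pi_less_4
    by (intro divide_right_mono mult_mono power_mono) (auto simp: power2_eq_square)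
  also have "\<dots> < 2 * r"
    using assms by simp
  also have "\<dots> \<le> phase_sq (of_real r)"
    using Re_Li2_quotient_mono(1)[of r r] assms by (simp add: phase_sq_of_real le_divide_eq)
  finally show ?thesis
    by (simp add: phase_gap_def)
qed

lemma open_phase_gap: "open {z \<in> ball 0 1. 0 < phase_gap z}" "open {z \<in> ball 0 1. phase_gap z < 0}"
proof -
  have c: "continuous_on (ball 0 1) phase_gap"
    by (rule continuous_on_subset[OF continuous_on_phase_gap]) auto
  have "open (ball 0 1 \<inter> phase_gap -` {0<..})" "open (ball 0 1 \<inter> phase_gap -` {..<0})"
    by (intro continuous_open_preimage c; simp)+
  moreover have "ball 0 1 \<inter> phase_gap -` {0<..} = {z \<in> ball 0 1. 0 < phase_gap z}"
    "ball 0 1 \<inter> phase_gap -` {..<0} = {z \<in> ball 0 1. phase_gap z < 0}"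
    by auto
  ultimately show "open {z \<in> ball 0 1. 0 < phase_gap z}" "open {z \<in> ball 0 1. phase_gap z < 0}"
    by simp_all
qed

lemma open_R_phase_1: "open (R_phase 1)"
proof -
  have "R_phase 1 = {z \<in> ball 0 1. 0 < phase_gap z} \<inter> {z. 0 < Re z}"
    by (auto simp: R_phase_1[unfolded One_nat_def])
  then show ?thesis
    by (simp only: open_Int open_phase_gap open_halfspace_Re_gt)
qed

lemma open_R_phase_4: "open (R_phase 4)"
proof -
  have "R_phase 4 = {z \<in> ball 0 1. phase_gap z < 0} \<inter> uminus ` {z \<in> ball 0 1. phase_gap z < 0}"
    by (auto simp: R_phase_4 mem_uminus_image_iff)
  then show ?thesis
    by (simp only: open_Int open_phase_gap open_negations)
qed

lemma not_in_closure:
  assumes "open U" "z \<in> U" "U \<inter> S = {}"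
  shows "z \<notin> closure S"
  using assms open_Int_closure_eq_empty by blast

lemma phase_gap_eq_if_Re_eq:
  assumes "norm z = norm w" "norm w \<le> 1" "Re z = Re w"
  shows "phase_gap z = phase_gap w"
proof -
  have "(Im z)\<^sup>2 = (Im w)\<^sup>2"
    using assms by (simp add: norm_complex_def)
  then have "z = w \<or> z = cnj w"
    using assms by (auto simp: complex_eq_iff power2_eq_iff)
  then show ?thesis
    using assms by (auto simp: phase_gap_cnj)
qed

text \<open>The subtracted term is even in z. In the right half disc a negative gap at z therefore
  suffices for membership in \<open>R_phase 4\<close>.\<close>

lemma phase_gap_uminus_le:
  assumes "norm z < 1" "0 \<le> Re z"
  shows "phase_gap (- z) \<le> phase_gap z"
  using phase_sq_mono_Re[of "- z" z] assms by (simp add: phase_gap_def)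

text \<open>Increasing Re z slightly on the same circle makes both defining inequalities strict;
  \<open>Re z < norm z\<close> leaves room for this.\<close>

lemma in_closure_R_phase_1:
  assumes "norm z < 1" "0 \<le> Re z" "Re z < norm z" "0 \<le> phase_gap z"
  shows "z \<in> closure (R_phase 1)"
  unfolding closure_approachable
proof (intro allI impI)
  fix e :: real assume "e > 0"
  then obtain d where d: "d > 0"
    "\<And>x. \<bar>x - Re z\<bar> < d \<Longrightarrow> \<bar>x\<bar> \<le> norm z \<Longrightarrow> \<exists>w. norm w = norm z \<and> Re w = x \<and> dist w z < e"
    by (rule nearby_same_norm[where z = z]) blast
  obtain x where x: "Re z < x" "x < min (norm z) (Re z + d)"
    using dense[of "Re z" "min (norm z) (Re z + d)"] assms d by auto
  then obtain w where w: "norm w = norm z" "Re w = x" "dist w z < e"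
    using d(2)[of x] assms by auto
  have "phase_gap z < phase_gap w"
    using w x assms by (intro phase_gap_strict_mono_Re) auto
  then have "w \<in> R_phase 1"
    using w x assms unfolding R_phase_1 by auto
  with w show "\<exists>y\<in>R_phase 1. dist y z < e" by blast
qed

lemma zero_in_closure_R_phase_1: "0 \<in> closure (R_phase 1)"
  unfolding closure_approachable
proof (intro allI impI)
  fix e :: real assume "e > 0"
  define r where "r = min (1 / 2) (e / 2)"
  have r: "0 < r" "r < 1" "r < e"
    using \<open>e > 0\<close> by (auto simp: r_def)
  then have "of_real r \<in> R_phase 1"
    unfolding R_phase_1 using phase_gap_of_real_pos by auto
  then show "\<exists>y\<in>R_phase 1. dist y 0 < e"
    using r by (intro bexI[of _ "of_real r"]) auto
qed

lemma gamma_right_Re_less: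
  assumes "z \<in> gamma_right"
  shows "Re z < norm z"
proof (rule ccontr)
  assume "\<not> Re z < norm z"
  then have "Re z = norm z"
    using complex_Re_le_cmod[of z] by simp
  moreover from this have "Im z = 0"
    using cmod_power2[of z] by simp
  ultimately have "z = of_real (norm z)"
    by (simp add: complex_eq_iff)
  then show False
    using phase_gap_of_real_pos[of "norm z"] assms by (auto simp: gamma_right_def)
qed

section \<open>Boundaries relative to a fixed critical radius\<close>

context
  fixes \<beta> :: real
  assumes \<beta>: "0 < \<beta>" "\<beta> < 1"
    and sgn_gap': "\<forall>r\<in>{0<..1}. sgn (phase_gap (of_real r * \<i>)) = sgn (\<beta> - r)"
begin

lemma sgn_gap: "0 < r \<Longrightarrow> r \<le> 1 \<Longrightarrow> sgn (phase_gap (of_real r * \<i>)) = sgn (\<beta> - r)"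
  using sgn_gap' by simp

lemma is_beta_iff_eq: "is_beta r \<longleftrightarrow> r = \<beta>"
proof
  assume "is_beta r"
  then have "0 < r" "r \<le> 1" "phase_gap (of_real r * \<i>) = 0"
    by (auto simp: is_beta_iff)
  then show "r = \<beta>" using sgn_gap[of r] by (simp add: sgn_0_0)
next
  assume "r = \<beta>"
  then show "is_beta r"
    using sgn_gap[of \<beta>] \<beta> by (simp add: is_beta_iff sgn_0_0)
qed

lemma sgn_phase_gap_imag:
  assumes "Re z = 0" "norm z < 1" "z \<noteq> 0"
  shows "sgn (phase_gap z) = sgn (\<beta> - norm z)"
proof -
  have "phase_gap z = phase_gap (of_real (norm z) * \<i>)"
    using assms by (intro phase_gap_eq_if_Re_eq) (auto simp: norm_mult)
  then show ?thesis
    using sgn_gap[of "norm z"] assms by simp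
qed

text \<open>On the right half of a circle the gap is smallest on the imaginary axis, where its sign
  is that of \<beta> - |z|.\<close>

lemma phase_gap_nonneg:
  assumes "0 \<le> Re z" "norm z \<le> \<beta>"
  shows "0 \<le> phase_gap z"
proof (cases "z = 0")
  case False
  let ?w = "of_real (norm z) * \<i>"
  have "0 \<le> sgn (phase_gap ?w)"
    using sgn_gap[of "norm z"] assms \<beta> False by simp
  then have "0 \<le> phase_gap ?w"
    by (simp add: sgn_if split: if_splits)
  also have "phase_gap ?w \<le> phase_gap z"
  proof (cases "Re z = 0")
    case True
    then have "phase_gap ?w = phase_gap z"
      using assms \<beta> by (intro phase_gap_eq_if_Re_eq) (auto simp: norm_mult)
    then show ?thesis by simp
  next
    case False
    then have "phase_gap ?w < phase_gap z"
      using assms \<beta> by (intro phase_gap_strict_mono_Re) (auto simp: norm_mult)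
    then show ?thesis by simp
  qed
  finally show ?thesis .
qed simp

text \<open>Closure points satisfy the weak inequalities. On the axis these mean |z| \<le> \<beta>;
  off the axis, lying outside the open region forces the gap to vanish.\<close>

lemma frontier_R_phase_1:
  "frontier (R_phase 1) \<inter> ball 0 1 = {z. Re z = 0 \<and> norm z \<le> \<beta>} \<union> gamma_right"
proof (intro subset_antisym subsetI)
  fix z assume "z \<in> frontier (R_phase 1) \<inter> ball 0 1"
  then have z: "z \<in> closure (R_phase 1)" "z \<notin> R_phase 1" "norm z < 1"
    using open_R_phase_1 by (auto simp: frontier_def interior_open)
  have "0 \<le> Re z"
  proof (rule ccontr)
    assume "\<not> 0 \<le> Re z"
    then have "z \<notin> closure (R_phase 1)"
      by (intro not_in_closure[OF open_halfspace_Re_lt[of 0]]) (auto simp: R_phase_1[unfolded One_nat_def])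
    with z show False by simp
  qed
  have "0 \<le> phase_gap z"
  proof (rule ccontr)
    assume "\<not> 0 \<le> phase_gap z"
    then have "z \<notin> closure (R_phase 1)"
      using z by (intro not_in_closure[OF open_phase_gap(2)]) (auto simp: R_phase_1[unfolded One_nat_def])
    with z show False by simp
  qed
  have "norm z \<le> \<beta>" if "Re z = 0"
  proof (cases "z = 0")
    case False
    have "0 \<le> sgn (phase_gap z)"
      using \<open>0 \<le> phase_gap z\<close> by (simp add: sgn_if)
    then have "0 \<le> sgn (\<beta> - norm z)"
      using sgn_phase_gap_imag[OF that z(3) False] by simp
    then show ?thesis by (simp add: sgn_if split: if_splits)
  qed (use \<beta> in simp)
  moreover have "z \<in> gamma_right" if "Re z \<noteq> 0"
    using that z \<open>0 \<le> Re z\<close> \<open>0 \<le> phase_gap z\<close> by (auto simp: gamma_right_def R_phase_1[unfolded One_nat_def])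
  ultimately show "z \<in> {z. Re z = 0 \<and> norm z \<le> \<beta>} \<union> gamma_right"
    by blast
next
  fix z assume z: "z \<in> {z. Re z = 0 \<and> norm z \<le> \<beta>} \<union> gamma_right"
  then have n: "norm z < 1"
    using \<beta> by (auto simp: gamma_right_def)
  have "z \<in> closure (R_phase 1)"
  proof (cases "z = 0")
    case True
    then show ?thesis by (simp add: zero_in_closure_R_phase_1[unfolded One_nat_def])
  next
    case False
    show ?thesis
      by (rule in_closure_R_phase_1)
         (use z n False gamma_right_Re_less[of z] phase_gap_nonneg[of z] in \<open>auto simp: gamma_right_def\<close>)
  qed
  moreover have "z \<notin> R_phase 1"
    using z unfolding R_phase_1 by (auto simp: gamma_right_def)
  ultimately show "z \<in> frontier (R_phase 1) \<inter> ball 0 1"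
    using n open_R_phase_1 by (auto simp: frontier_def interior_open)
qed

text \<open>Keeps the region away from the origin, which therefore is not one of its boundary
  points.\<close>

lemma norm_gt_if_R_phase_4:
  assumes "z \<in> R_phase 4"
  shows "\<beta> < norm z"
proof (rule ccontr)
  assume "\<not> \<beta> < norm z"
  then have "0 \<le> phase_gap z \<or> 0 \<le> phase_gap (- z)"
    using phase_gap_nonneg[of z] phase_gap_nonneg[of "- z"] by fastforce
  then show False
    using assms by (auto simp: R_phase_4)
qed

lemma frontier_R_phase_4_aux:
  assumes "z \<in> frontier (R_phase 4)" "norm z < 1" "0 \<le> Re z"
  shows "z \<in> gamma_right"
proof -
  have z: "z \<in> closure (R_phase 4)" "z \<notin> R_phase 4"
    using assms open_R_phase_4 by (auto simp: frontier_def interior_open)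
  have "z \<noteq> 0"
  proof
    assume "z = 0"
    then have "z \<notin> closure (R_phase 4)"
      using \<beta> norm_gt_if_R_phase_4 by (intro not_in_closure[of "ball 0 \<beta>"]) force+
    with z show False by simp
  qed
  moreover have "\<not> 0 < phase_gap z"
  proof
    assume "0 < phase_gap z"
    then have "z \<notin> closure (R_phase 4)"
      using assms by (intro not_in_closure[OF open_phase_gap(1)]) (auto simp: R_phase_4)
    with z show False by simp
  qed
  moreover have "\<not> phase_gap z < 0"
    using z(2) phase_gap_uminus_le[OF assms(2,3)] assms by (auto simp: R_phase_4)
  ultimately show ?thesis
    using assms by (auto simp: gamma_right_def)
qed

text \<open>Off the imaginary axis, a slight decrease of Re z on the same circle makes the gap
  negative. On the axis this would leave the right half disc, so the point is moved outward along
  the axis instead.\<close>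

lemma gamma_right_in_closure_R_phase_4:
  assumes "z \<in> gamma_right"
  shows "z \<in> closure (R_phase 4)"
  unfolding closure_approachable
proof (intro allI impI)
  have z: "z \<noteq> 0" "norm z < 1" "0 \<le> Re z" "phase_gap z = 0"
    using assms by (auto simp: gamma_right_def)
  have R4: "w \<in> R_phase 4" if "norm w < 1" "0 \<le> Re w" "phase_gap w < 0" for w
    using that phase_gap_uminus_le[of w] by (auto simp: R_phase_4)
  fix e :: real assume "e > 0"
  show "\<exists>y\<in>R_phase 4. dist y z < e"
  proof (cases "Re z = 0")
    case True
    obtain s where s: "norm z < s" "s < min 1 (norm z + e)"
      using dense[of "norm z" "min 1 (norm z + e)"] z \<open>e > 0\<close> by auto
    define w where "w = of_real (s / norm z) * z"
    have "0 < s"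
      using s norm_ge_zero[of z] by linarith
    then have norm_w: "norm w = s"
      using z by (simp add: w_def norm_mult norm_divide)
    \<comment> \<open>A zero of the gap on the axis must have modulus \<beta>, so every larger
      radius below 1 gives a negative gap.\<close>
    have "\<beta> = norm z"
      using sgn_phase_gap_imag[OF True] z by (simp add: sgn_0_0)
    then have "sgn (phase_gap w) = - 1"
      using sgn_phase_gap_imag[of w] norm_w s z True \<open>0 < s\<close> by (auto simp: w_def)
    then have R: "w \<in> R_phase 4"
      using norm_w s True by (intro R4) (auto simp: w_def sgn_if split: if_splits)
    have "dist w z = norm (of_real (s / norm z - 1) * z)"
      by (simp add: dist_norm w_def algebra_simps)
    moreover have "s / norm z - 1 \<ge> 0"
      using z s by (simp add: le_divide_eq)
    ultimately have "dist w z = s - norm z"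
      using z by (simp add: norm_mult left_diff_distrib del: of_real_diff of_real_divide)
    with R show ?thesis
      using s by (intro bexI[of _ w]) auto
  next
    case False
    from \<open>e > 0\<close> obtain d where d: "d > 0"
      "\<And>x. \<bar>x - Re z\<bar> < d \<Longrightarrow> \<bar>x\<bar> \<le> norm z \<Longrightarrow> \<exists>w. norm w = norm z \<and> Re w = x \<and> dist w z < e"
      by (rule nearby_same_norm[where z = z]) blast
    obtain x where x: "max 0 (Re z - d) < x" "x < Re z"
      using dense[of "max 0 (Re z - d)" "Re z"] False z d by auto
    then obtain w where w: "norm w = norm z" "Re w = x" "dist w z < e"
      using d(2)[of x] complex_Re_le_cmod[of z] by auto
    have "phase_gap w < phase_gap z"
      using w x z by (intro phase_gap_strict_mono_Re) auto
    then show ?thesis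
      using w x z by (intro bexI[of _ w] R4) auto
  qed
qed

text \<open>The region is invariant under z \<mapsto> -z, which transfers the analysis of the right
  half disc to the left.\<close>

lemma frontier_R_phase_4:
  "frontier (R_phase 4) \<inter> ball 0 1 = gamma_right \<union> uminus ` gamma_right"
proof (intro subset_antisym subsetI)
  have sym: "- z \<in> frontier (R_phase 4)" if "z \<in> frontier (R_phase 4)" for z
    using that frontier_uminus[of "R_phase 4"] unfolding uminus_R_phase_4 by blast
  {
    fix z assume z: "z \<in> frontier (R_phase 4) \<inter> ball 0 1"
    show "z \<in> gamma_right \<union> uminus ` gamma_right"
    proof (cases "0 \<le> Re z")
      case True
      then show ?thesis using z frontier_R_phase_4_aux by auto
    next
      case False
      then have "- z \<in> gamma_right"
        using z sym[of z] by (intro frontier_R_phase_4_aux) auto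
      then show ?thesis by (metis UnI2 image_eqI minus_minus)
    qed
  next
    have "z \<in> frontier (R_phase 4)" "norm z < 1" if "z \<in> gamma_right" for z
      using gamma_right_in_closure_R_phase_4[OF that] that open_R_phase_4
      by (auto simp: frontier_def interior_open gamma_right_def R_phase_4)
    then show "z \<in> frontier (R_phase 4) \<inter> ball 0 1" if "z \<in> gamma_right \<union> uminus ` gamma_right" for z
      using that sym by auto
  }
qed

lemma nonempty_R_phase_iff:
  assumes "m \<ge> 1"
  shows "R_phase m \<noteq> {} \<longleftrightarrow> m \<in> {1, 2, 4}"
proof -
  have "R_phase 1 \<noteq> {}"
    using zero_in_closure_R_phase_1 by auto
  moreover from this have "R_phase 2 \<noteq> {}"
    by (simp add: R_phase_2)
  moreover obtain r where r: "\<beta> < r" "r < 1"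
    using \<beta> dense by blast
  then have "phase_gap (of_real r * \<i>) < 0"
    using sgn_gap[of r] \<beta> by (simp add: sgn_if split: if_splits)
  then have "of_real r * \<i> \<in> R_phase 4"
    using r \<beta> phase_gap_uminus_le[of "of_real r * \<i>"] by (auto simp: R_phase_4 norm_mult)
  ultimately show ?thesis
    using R_phase_empty[OF assms] by auto
qed

end

theorem mainTheorem4:
  shows "{m::nat. m \<ge> 1 \<and> R_phase m \<noteq> {}} = {1, 2, 4} \<and>
    (\<exists>!\<beta>. is_beta \<beta>) \<and>
    (\<forall>\<beta>. is_beta \<beta> \<longrightarrow>
       frontier (R_phase 4) \<inter> ball 0 1 =
         gamma_curve \<union> uminus ` gamma_curve \<union> cnj ` gamma_curve
           \<union> (\<lambda>z. - cnj z) ` gamma_curve \<and>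
       frontier (R_phase 1) \<inter> ball 0 1 =
         imag_seg 0 \<beta> \<union> imag_seg (- \<beta>) 0 \<union> gamma_curve \<union> cnj ` gamma_curve \<and>
       frontier (R_phase 2) \<inter> ball 0 1 =
         imag_seg 0 \<beta> \<union> imag_seg (- \<beta>) 0 \<union> uminus ` gamma_curve
           \<union> (\<lambda>z. - cnj z) ` gamma_curve)"
proof -
  obtain \<beta> where \<beta>: "0 < \<beta>" "\<beta> < 1"
    and sgn_gap: "\<forall>r\<in>{0<..1}. sgn (phase_gap (of_real r * \<i>)) = sgn (\<beta> - r)"
    by (rule phase_gap_axis_sign_change) (rule that)
  note is_beta = is_beta_iff_eq[OF \<beta> sgn_gap]
    and F1 = frontier_R_phase_1[OF \<beta> sgn_gap]
    and F4 = frontier_R_phase_4[OF \<beta> sgn_gap]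
  have nonempty: "{m::nat. m \<ge> 1 \<and> R_phase m \<noteq> {}} = {1, 2, 4}"
  proof (intro set_eqI)
    fix m :: nat
    show "m \<in> {m. m \<ge> 1 \<and> R_phase m \<noteq> {}} \<longleftrightarrow> m \<in> {1, 2, 4}"
    proof (cases "m \<ge> 1")
      case True
      then show ?thesis
        using nonempty_R_phase_iff[OF \<beta> sgn_gap True] by simp
    qed auto
  qed
  have B4: "frontier (R_phase 4) \<inter> ball 0 1 =
         gamma_curve \<union> uminus ` gamma_curve \<union> cnj ` gamma_curve
           \<union> (\<lambda>z. - cnj z) ` gamma_curve"
    unfolding F4 uminus_gamma_right_conv unfolding gamma_right_conv by (simp only: Un_ac)
  have B1: "frontier (R_phase 1) \<inter> ball 0 1 =
         imag_seg 0 \<beta> \<union> imag_seg (- \<beta>) 0 \<union> gamma_curve \<union> cnj ` gamma_curve"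
    unfolding F1 imag_seg_conv[OF \<beta>(1)] gamma_right_conv by (simp only: Un_ac)
  have axis: "uminus ` {z. Re z = 0 \<and> norm z \<le> \<beta>} = {z. Re z = 0 \<and> norm z \<le> \<beta>}"
    by (auto simp: mem_uminus_image_iff)
  have "frontier (R_phase 2) \<inter> ball 0 1 = uminus ` (frontier (R_phase 1) \<inter> ball 0 1)"
    unfolding R_phase_2 frontier_uminus
    by (intro set_eqI) (simp add: mem_uminus_image_iff)
  then have B2: "frontier (R_phase 2) \<inter> ball 0 1 =
         imag_seg 0 \<beta> \<union> imag_seg (- \<beta>) 0 \<union> uminus ` gamma_curve
           \<union> (\<lambda>z. - cnj z) ` gamma_curve"
    unfolding F1 image_Un axis uminus_gamma_right_conv imag_seg_conv[OF \<beta>(1)]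
    by (simp only: Un_ac)
  from nonempty B4 B1 B2 show ?thesis
    unfolding is_beta by (intro conjI ex1I[of _ \<beta>] allI impI) (simp_all only:)
qed

end
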